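(* Let $\xi$ be a random connection model on $\mathbb{X}$ with connection function $\varphi$, based on a Poisson process $\eta$ with diffuse locally finite intensity measure $\lambda$. (1) If $\xi$ is irreducible and the infinite clusters of $\xi$ are deletion stable, then $\xi$ has $\mathbb{P}$-almost surely at most one infinite cluster. (2) Conversely, if $\xi$ has $\mathbb{P}$-almost surely at most one infinite cluster, then the infinite clusters of $\xi$ are deletion stable.
   Context: Setting. $\mathbb{X}$ is a complete separable metric space with Borel $\sigma$-field $\mathcal{X}$; $\lambda$ is a locally finite (finite on bounded Borel sets) and diffuse measure on $\mathbb{X}$; $\varphi\colon\mathbb{X}^2\to[0,1]$ is measurable and symmetric (the connection function) with $D_\varphi(x):=\int\varphi(x,y)\,\lambda(dy)<\infty$ for $\lambda$-a.e. $x\in\mathbb{X}$. Graphs. $\mathbf{N}$ is the space of simple locally finite counting measures on $\mathbb{X}$ (identified with their supports), with the standard $\sigma$-field. $\mathbf{G}$ is the space of undirected loop-free graphs $\mu$ whose vertex set $V(\mu)$ is an element of $\mathbf{N}$; formally $\mu$ is a counting measure on $\mathbb{X}\times\mathbf{N}$ with one atom $(x,\psi_x)$ per vertex $x$, $\psi_x$ being the set of neighbours of $x$; $\mathbf{G}$ carries the standard $\sigma$-field generated by the evaluation maps. Random connection model (RCM). Given a simple point process $\chi$ on $\mathbb{X}$, the RCM based on $\chi$ is the random graph with vertex set $\chi$ in which, given $\chi$, each pair of distinct points $x,y$ of $\chi$ is joined by an edge with probability $\varphi(x,y)$, independently for different pairs. Here $\eta$ is a Poisson process on $\mathbb{X}$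 with intensity measure $\lambda$ and $\xi$ is the RCM based on $\eta$. For $x_1,\ldots,x_n\in\mathbb{X}$, $\xi^{x_1,\ldots,x_n}$ is the RCM based on $\eta+\delta_{x_1}+\cdots+\delta_{x_n}$ (multiplicities removed), obtained from $\xi$ by successively adding $x_1,\ldots,x_n$ with independent connection decisions. Clusters. A cluster is a connected component; it is infinite if it has infinitely many vertices. $C^x(\mu)$ is the component of $x$ in $\mu$ (as a graph), and $\mu-\delta_x$ is the graph obtained from $\mu$ by deleting the vertex $x$ and all its edges. $x\leftrightarrow y$ in $\mu$ means that $x,y$ are vertices connected by a path in $\mu$. Irreducibility. $\xi$ is irreducible if $\mathbb{P}(x_1\leftrightarrow x_2 \text{ in }\xi^{x_1,x_2})>0$ for $\lambda^2$-a.e. $(x_1,x_2)\in\mathbb{X}^2$. Deletion stability. $N^\infty(x,\mu)$ denotes the number of infinite clusters in $C^x(\mu)-\delta_x$. The infinite clusters of $\xi$ are deletion stable if $\mathbb{P}(N^\infty(x,\xi^x)\ge 2)=0$ for $\lambda$-a.e. $x\in\mathbb{X}$. *)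

theory Defs
  imports "HOL-Probability.Probability"
begin

section \<open>Locally finite point configurations\<close>

definition ecard :: "'a set \<Rightarrow> enat" where
  "ecard A = (if finite A then enat (card A) else \<infinity>)"

text \<open>
  A simple locally finite counting measure is represented by its support; the mass it gives to
  a set \<open>B\<close> is then \<open>ecard (V \<inter> B)\<close>.
\<close>

definition configs :: "'a::metric_space set set" where
  "configs = {V. \<forall>B. bounded B \<longrightarrow> finite (V \<inter> B)}"

definition config_space :: "'a::metric_space set measure" where
  "config_space =
     sigma configs {{V \<in> configs. ecard (V \<inter> B) = k} |B k. B \<in> sets borel}"

section \<open>Graphs\<close>

text \<open>
  A graph is a pair of a vertex set and a symmetric irreflexive adjacency relation. As a
  counting measure on pairs of a point and a configuration it has the atoms
  \<open>(x, neighbours \<mu> x)\<close>, where \<open>x\<close> ranges over the vertices of \<open>\<mu>\<close>.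
\<close>

type_synonym 'a graph = "'a set \<times> ('a \<times> 'a) set"

abbreviation verts :: "'a graph \<Rightarrow> 'a set" where "verts \<equiv> fst"
abbreviation adj :: "'a graph \<Rightarrow> ('a \<times> 'a) set" where "adj \<equiv> snd"

definition neighbours :: "'a graph \<Rightarrow> 'a \<Rightarrow> 'a set" where
  "neighbours \<mu> x = adj \<mu> `` {x}"

definition graphs :: "'a::metric_space graph set" where
  "graphs = {\<mu>. verts \<mu> \<in> configs \<and> adj \<mu> \<subseteq> verts \<mu> \<times> verts \<mu> \<and> sym (adj \<mu>) \<and> irrefl (adj \<mu>)}"

definition graph_space :: "'a::metric_space graph measure" where
  "graph_space =
     sigma graphs {{\<mu> \<in> graphs. ecard {x \<in> verts \<mu>. (x, neighbours \<mu> x) \<in> A} = k} |A k.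
                    A \<in> sets (borel \<Otimes>\<^sub>M config_space)}"

definition connected_in :: "'a graph \<Rightarrow> 'a \<Rightarrow> 'a \<Rightarrow> bool" where
  "connected_in \<mu> x y \<longleftrightarrow> x \<in> verts \<mu> \<and> y \<in> verts \<mu> \<and> (x, y) \<in> (adj \<mu>)\<^sup>*"

definition induced :: "'a graph \<Rightarrow> 'a set \<Rightarrow> 'a graph" where
  "induced \<mu> W = (verts \<mu> \<inter> W, adj \<mu> \<inter> (W \<times> W))"

definition component :: "'a \<Rightarrow> 'a graph \<Rightarrow> 'a graph" where
  "component x \<mu> = induced \<mu> {y. connected_in \<mu> x y}"

definition delete_vertex :: "'a graph \<Rightarrow> 'a \<Rightarrow> 'a graph" where
  "delete_vertex \<mu> x = induced \<mu> (- {x})"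

definition infinite_clusters :: "'a graph \<Rightarrow> 'a graph set" where
  "infinite_clusters \<mu> = {component x \<mu> |x. x \<in> verts \<mu> \<and> infinite (verts (component x \<mu>))}"

definition N_inf :: "'a \<Rightarrow> 'a graph \<Rightarrow> enat" where
  "N_inf x \<mu> = ecard (infinite_clusters (delete_vertex (component x \<mu>) x))"

section \<open>Poisson processes\<close>

definition locally_finite_measure :: "'a::metric_space measure \<Rightarrow> bool" where
  "locally_finite_measure L \<longleftrightarrow> (\<forall>B\<in>sets borel. bounded B \<longrightarrow> emeasure L B < \<infinity>)"

definition diffuse :: "'a measure \<Rightarrow> bool" where
  "diffuse L \<longleftrightarrow> (\<forall>x. emeasure L {x} = 0)"

text \<open>
  The Poisson probabilities are written out because \<^const>\<open>poisson_pmf\<close> is only specified for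
  a positive parameter; here the parameter \<open>0\<close> yields the point mass at \<open>0\<close>, and the Poisson
  distribution with parameter \<open>\<infinity>\<close> is the point mass at \<open>\<infinity>\<close>.
\<close>

definition poisson_process ::
    "'w measure \<Rightarrow> 'a::metric_space measure \<Rightarrow> ('w \<Rightarrow> 'a set) \<Rightarrow> bool" where
  "poisson_process M L \<eta> \<longleftrightarrow>
     prob_space M \<and> \<eta> \<in> M \<rightarrow>\<^sub>M config_space \<and>
     (\<forall>B\<in>sets borel. emeasure L B < \<infinity> \<longrightarrow>
        (\<forall>k. \<P>(\<omega> in M. ecard (\<eta> \<omega> \<inter> B) = enat k) =
               measure L B ^ k / fact k * exp (- measure L B))) \<and>
     (\<forall>B\<in>sets borel. emeasure L B = \<infinity> \<longrightarrow> (AE \<omega> in M. ecard (\<eta> \<omega> \<inter> B) = \<infinity>)) \<and>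
     (\<forall>(n::nat) B. (\<forall>i<n. B i \<in> sets borel) \<longrightarrow> disjoint_family_on B {..<n} \<longrightarrow>
        prob_space.indep_vars M (\<lambda>_. count_space UNIV) (\<lambda>i \<omega>. ecard (\<eta> \<omega> \<inter> B i)) {..<n})"

section \<open>The random connection model\<close>

definition connection_function ::
    "'a::metric_space measure \<Rightarrow> ('a \<Rightarrow> 'a \<Rightarrow> real) \<Rightarrow> bool" where
  "connection_function L \<phi> \<longleftrightarrow>
     case_prod \<phi> \<in> borel_measurable (borel \<Otimes>\<^sub>M borel) \<and>
     (\<forall>x y. 0 \<le> \<phi> x y \<and> \<phi> x y \<le> 1) \<and>
     (\<forall>x y. \<phi> x y = \<phi> y x) \<and>
     (AE x in L. (\<integral>\<^sup>+ y. ennreal (\<phi> x y) \<partial>L) < \<infinity>)"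

definition pairs :: "'a set \<Rightarrow> 'a set set" where
  "pairs V = {{x, y} |x y. x \<in> V \<and> y \<in> V \<and> x \<noteq> y}"

text \<open>Well defined on unordered pairs because \<open>\<phi>\<close> is symmetric.\<close>

definition edge_prob :: "('a \<Rightarrow> 'a \<Rightarrow> real) \<Rightarrow> 'a set \<Rightarrow> real" where
  "edge_prob \<phi> e = (THE p. \<exists>x y. e = {x, y} \<and> p = \<phi> x y)"

definition graph_of :: "'a set \<Rightarrow> ('a set \<Rightarrow> bool) \<Rightarrow> 'a graph" where
  "graph_of V s = (V, {(x, y). x \<in> V \<and> y \<in> V \<and> x \<noteq> y \<and> s {x, y}})"

text \<open>
  The conditional law of the random connection model given its vertex set \<open>V\<close>: the edge
  indicators of the unordered pairs of distinct points of \<open>V\<close> are independent Bernoulli variables.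
\<close>

definition rcm_kernel ::
    "('a::metric_space \<Rightarrow> 'a \<Rightarrow> real) \<Rightarrow> 'a set \<Rightarrow> 'a graph measure" where
  "rcm_kernel \<phi> V =
     distr (\<Pi>\<^sub>M e\<in>pairs V. measure_pmf (bernoulli_pmf (edge_prob \<phi> e))) graph_space (graph_of V)"

text \<open>The law of the random connection model based on the point process \<open>\<zeta>\<close>.\<close>

definition rcm_law ::
    "('a::metric_space \<Rightarrow> 'a \<Rightarrow> real) \<Rightarrow> 'w measure \<Rightarrow> ('w \<Rightarrow> 'a set) \<Rightarrow> 'a graph measure" where
  "rcm_law \<phi> M \<zeta> = distr M config_space \<zeta> \<bind> rcm_kernel \<phi>"

text \<open>
  Since \<open>\<zeta>\<close> is the vertex set of \<open>\<xi>\<close>, hence a function of \<open>\<xi>\<close>, prescribing the law of \<open>\<xi>\<close> as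
  below is the same as prescribing \<open>rcm_kernel \<phi> (\<zeta> \<omega>)\<close> as the conditional law of \<open>\<xi>\<close> given \<open>\<zeta>\<close>.
\<close>

definition is_rcm ::
    "('a::metric_space \<Rightarrow> 'a \<Rightarrow> real) \<Rightarrow> 'w measure \<Rightarrow> ('w \<Rightarrow> 'a set) \<Rightarrow> ('w \<Rightarrow> 'a graph) \<Rightarrow> bool"
  where
  "is_rcm \<phi> M \<zeta> \<xi> \<longleftrightarrow>
     \<xi> \<in> M \<rightarrow>\<^sub>M graph_space \<and> (\<forall>\<omega>\<in>space M. verts (\<xi> \<omega>) = \<zeta> \<omega>) \<and>
     distr M graph_space \<xi> = rcm_law \<phi> M \<zeta>"

text \<open>
  The law of the graph \<open>\<xi>\<close> with the points \<open>xs\<close> added, i.e. of the random connection model based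
  on \<open>\<eta>\<close> together with \<open>xs\<close>; only probabilities of events of one such graph are used, so its
  coupling with \<open>\<xi>\<close> is immaterial.
\<close>

definition rcm_added ::
    "('a::metric_space \<Rightarrow> 'a \<Rightarrow> real) \<Rightarrow> 'w measure \<Rightarrow> ('w \<Rightarrow> 'a set) \<Rightarrow> 'a list \<Rightarrow> 'a graph measure"
  where
  "rcm_added \<phi> M \<eta> xs = rcm_law \<phi> M (\<lambda>\<omega>. \<eta> \<omega> \<union> set xs)"

definition irreducible_rcm ::
    "'a::metric_space measure \<Rightarrow> ('a \<Rightarrow> 'a \<Rightarrow> real) \<Rightarrow> 'w measure \<Rightarrow> ('w \<Rightarrow> 'a set) \<Rightarrow> bool" where
  "irreducible_rcm L \<phi> M \<eta> \<longleftrightarrow>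
     (AE (x1, x2) in L \<Otimes>\<^sub>M L. \<P>(\<mu> in rcm_added \<phi> M \<eta> [x1, x2]. connected_in \<mu> x1 x2) > 0)"

definition deletion_stable ::
    "'a::metric_space measure \<Rightarrow> ('a \<Rightarrow> 'a \<Rightarrow> real) \<Rightarrow> 'w measure \<Rightarrow> ('w \<Rightarrow> 'a set) \<Rightarrow> bool" where
  "deletion_stable L \<phi> M \<eta> \<longleftrightarrow>
     (AE x in L. AE \<mu> in rcm_added \<phi> M \<eta> [x]. \<not> N_inf x \<mu> \<ge> 2)"

end

theory Submission
  imports Defs
begin

text \<open>
  Call two points separated in a graph if they lie in different infinite clusters, and say that
  a vertex splits a graph if deleting it breaks its cluster into at least two infinite ones.

  From uniqueness to stability: the intensity has no atoms, so a fixed point \<open>x\<close> is almost surely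
  not a point of \<open>\<eta>\<close>, and deleting \<open>x\<close> from \<open>\<xi>\<^sup>x\<close> gives back a copy of \<open>\<xi>\<close>. If \<open>x\<close> splits \<open>\<xi>\<^sup>x\<close>, then
  this copy has two infinite clusters (\<open>stable_if_unique\<close>).

  From stability to uniqueness (\<open>unique_if_stable\<close>): let \<open>S\<close> be the set of all pairs \<open>(x, y)\<close> which
  are separated in \<open>\<xi>\<^sup>x\<^sup>,\<^sup>y\<close> with positive probability (\<open>may_separate\<close>). By the Mecke equation, applied
  twice, it suffices that \<open>S\<close> is a null set. Call a graph good if no vertex splits it and all its
  separated pairs belong to \<open>S\<close>. By stability and the Mecke equation \<open>\<xi>\<close> is almost surely good, and
  therefore so is \<open>\<xi>\<^sup>x\<^sup>,\<^sup>y\<^sup>,\<^sup>z\<close> for almost all \<open>x, y, z\<close>. Suppose now that \<open>(x, y) \<in> S\<close> and that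
  \<open>\<phi> z x > 0\<close>. The edges at the new point \<open>z\<close> are independent of \<open>\<xi>\<^sup>x\<^sup>,\<^sup>y\<close>, so with positive probability
  \<open>x\<close> and \<open>y\<close> are separated before \<open>z\<close> is added and \<open>z\<close> is a neighbour of \<open>x\<close>. As \<open>z\<close> does not split
  the graph, it does not meet the cluster of \<open>y\<close>. Thus \<open>z\<close> and \<open>y\<close> are separated, whence
  \<open>(z, y) \<in> S\<close>; and \<open>z\<close> cannot be a neighbour of \<open>y\<close>, whence \<open>\<phi> z y = 0\<close>
  (\<open>may_separate_propagates\<close>).

  Consequently, for almost every \<open>y\<close> the section \<open>S\<^sub>y\<close> is closed, up to null sets, under passing from
  \<open>x\<close> to points \<open>z\<close> with \<open>\<phi> z x > 0\<close>. A path from a point inside \<open>S\<^sub>y\<close> to a point outside would have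
  to use an edge of probability zero, so irreducibility makes \<open>S\<^sub>y\<close> null or conull
  (\<open>AE_crossing\<close>). If it were conull, then \<open>\<phi> z x > 0\<close> would imply \<open>\<phi> z y = 0\<close> for almost all \<open>x\<close>
  and \<open>z\<close>. Irreducibility also says that almost every \<open>z\<close> has \<open>\<phi> z x > 0\<close> for a non-null set
  of \<open>x\<close>; hence \<open>\<phi> z y = 0\<close> for almost all \<open>z\<close>, which is excluded for almost every \<open>y\<close> by the same
  fact.

  All of these steps concern null events. The Mecke equation is used in the form that a property
  holds almost surely at all points of \<open>\<eta>\<close> if and only if it holds, for almost all \<open>x\<close>, almost
  surely at \<open>x\<close> when \<open>x\<close> is added to \<open>\<eta>\<close> (\<open>AE_ball_iff_AE_insert\<close>). Behind all of this lies
  measurability: the points of a configuration are indexed, in a measurable way, by the members of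
  a countable base of the topology which isolate them. Quantifiers over vertices become countable,
  so all graph properties involved are measurable, and the random connection model given its
  vertices depends measurably on them (\<open>measurable_rcm_kernel\<close>).
\<close>

section \<open>A countable enumeration of the points of a configuration\<close>

text \<open>A sequence that runs through a countable base of the topology; the numbers of its members
  serve as indices of points.\<close>

definition base_set :: "nat \<Rightarrow> 'a::polish_space set" where
  "base_set = (SOME U. topological_basis (range U))"

lemma base_set_basis: "topological_basis (range (base_set :: nat \<Rightarrow> 'a::polish_space set))"
proof -
  obtain B :: "'a set set" where B: "countable B" "topological_basis B"
    using ex_countable_basis by blast
  have "B \<noteq> {}"
    using topological_basisE[OF B(2) open_UNIV UNIV_I] by blast
  then have "topological_basis (range (from_nat_into B))"
    using B by (simp add: range_from_nat_into)
  then show ?thesis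
    unfolding base_set_def by (rule someI[where P = "\<lambda>U. topological_basis (range U)"])
qed

lemma open_base_set: "open (base_set n)"
  using base_set_basis topological_basis_open by blast

lemma base_set_borel [measurable]: "base_set n \<in> sets borel"
  by (simp add: open_base_set)

lemma base_set_nbhd:
  assumes "open S" "x \<in> S"
  obtains n where "x \<in> base_set n" "base_set n \<subseteq> S"
  using topological_basisE[OF base_set_basis assms] by blast

lemma finite_separated_by_base_set:
  fixes F :: "'a::polish_space set"
  assumes "finite F"
  obtains f where "\<And>x. x \<in> F \<Longrightarrow> x \<in> base_set (f x)"
    and "\<And>x y. x \<in> F \<Longrightarrow> y \<in> F \<Longrightarrow> x \<noteq> y \<Longrightarrow> base_set (f x) \<inter> (base_set (f y) :: 'a set) = {}"
proof -
  have "\<forall>x. \<exists>d>0. \<forall>y\<in>F. y \<noteq> x \<longrightarrow> d \<le> dist x y"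
    using finite_set_avoid[OF assms] by blast
  then obtain d where d: "\<And>x. d x > 0" "\<And>x y. y \<in> F \<Longrightarrow> y \<noteq> x \<Longrightarrow> d x \<le> dist x y"
    by metis
  have "\<exists>n. x \<in> base_set n \<and> base_set n \<subseteq> ball x (d x / 2)" for x
    using base_set_nbhd[of "ball x (d x / 2)" x] d(1)[of x] by auto
  then obtain f where f: "\<And>x. x \<in> base_set (f x)" "\<And>x. base_set (f x) \<subseteq> ball x (d x / 2)"
    by metis
  show thesis
  proof (rule that[of f])
    fix x y assume xy: "x \<in> F" "y \<in> F" "x \<noteq> y"
    show "base_set (f x) \<inter> (base_set (f y) :: 'a set) = {}"
    proof (rule ccontr)
      assume "base_set (f x) \<inter> (base_set (f y) :: 'a set) \<noteq> {}"
      then obtain z :: 'a where "z \<in> base_set (f x)" "z \<in> base_set (f y)"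
        by blast
      then have "z \<in> ball x (d x / 2)" "z \<in> ball y (d y / 2)"
        using f(2)[of x] f(2)[of y] by auto
      then have "dist x z < d x / 2" "dist y z < d y / 2"
        by auto
      moreover have "dist x y \<le> dist x z + dist y z"
        by (rule dist_triangle2)
      moreover have "d x \<le> dist x y" "d y \<le> dist x y"
        using d(2)[of y x] d(2)[of x y] xy by (auto simp: dist_commute)
      ultimately show False by linarith
    qed
  qed (use f in auto)
qed

text \<open>Only finitely many other points of a locally finite set lie in a ball around \<open>x\<close>, so some
  base set inside this ball avoids them.\<close>

lemma configs_isolated:
  fixes V :: "'a::polish_space set"
  assumes "V \<in> configs" "x \<in> V"
  obtains n where "V \<inter> base_set n = {x}"
proof -
  have fin: "finite (V \<inter> ball x 1)"
    using assms by (simp add: configs_def)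
  have "open (ball x 1 - (V \<inter> ball x 1 - {x}))"
    using fin by (intro open_Diff finite_imp_closed) auto
  then obtain n where "x \<in> base_set n" "base_set n \<subseteq> ball x 1 - (V \<inter> ball x 1 - {x})"
    using base_set_nbhd[of "ball x 1 - (V \<inter> ball x 1 - {x})" x] by (metis DiffI Diff_iff centre_in_ball insertI1 zero_less_one)
  then have "V \<inter> base_set n = {x}"
    using assms by auto
  then show thesis by (rule that)
qed

text \<open>The index of a point is the number of the first base set that isolates it. A number need not be
  the index of a point; \<open>is_pt\<close> singles out those that are. Isolating a point is a statement about the
  numbers of points in Borel sets, which makes this indexing measurable.\<close>

definition idx :: "'a::polish_space set \<Rightarrow> 'a \<Rightarrow> nat" where
  "idx V x = (LEAST n. V \<inter> base_set n = {x})"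

definition is_pt :: "nat \<Rightarrow> 'a::polish_space set \<Rightarrow> bool" where
  "is_pt n V \<longleftrightarrow> (\<exists>x. V \<inter> base_set n = {x}) \<and> (\<forall>m<n. V \<inter> base_set m \<noteq> V \<inter> base_set n)"

definition pt :: "nat \<Rightarrow> 'a::polish_space set \<Rightarrow> 'a" where
  "pt n V = (if is_pt n V then the_elem (V \<inter> base_set n) else undefined)"

lemma pt_in: "is_pt n V \<Longrightarrow> pt n V \<in> V"
  and base_set_pt: "is_pt n V \<Longrightarrow> V \<inter> base_set n = {pt n V}"
  and idx_pt: "is_pt n V \<Longrightarrow> idx V (pt n V) = n"
proof -
  assume n: "is_pt n V"
  then obtain x where x: "V \<inter> base_set n = {x}" "\<And>m. m < n \<Longrightarrow> V \<inter> base_set m \<noteq> {x}"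
    by (auto simp: is_pt_def)
  then have [simp]: "pt n V = x"
    using n by (simp add: pt_def)
  show "pt n V \<in> V" "V \<inter> base_set n = {pt n V}"
    using x by auto
  show "idx V (pt n V) = n"
    unfolding idx_def using x by (auto intro!: Least_equality simp: not_less[symmetric])
qed

lemma
  assumes "V \<in> configs" "x \<in> V"
  shows is_pt_idx: "is_pt (idx V x) V" and pt_idx: "pt (idx V x) V = x"
proof -
  have *: "V \<inter> base_set (idx V x) = {x}"
    unfolding idx_def by (rule LeastI_ex) (use configs_isolated[OF assms] in blast)
  have "V \<inter> base_set m \<noteq> {x}" if "m < idx V x" for m
    using that not_less_Least unfolding idx_def by blast
  with * show 1: "is_pt (idx V x) V"
    by (auto simp: is_pt_def)
  show "pt (idx V x) V = x"
    using base_set_pt[OF 1] * by simp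
qed

lemma inj_on_idx: "V \<in> configs \<Longrightarrow> inj_on (idx V) V"
  by (rule inj_on_inverseI[where g = "\<lambda>n. pt n V"]) (simp add: pt_idx)

lemma countable_configs: "(V :: 'a::polish_space set) \<in> configs \<Longrightarrow> countable V"
  by (rule countableI[OF inj_on_idx])

lemma ex_pt_iff: "V \<in> configs \<Longrightarrow> (\<exists>x\<in>V. P x) \<longleftrightarrow> (\<exists>n. is_pt n V \<and> P (pt n V))"
proof
  assume V: "V \<in> configs" and "\<exists>x\<in>V. P x"
  then obtain x where "x \<in> V" "P x" by blast
  with V show "\<exists>n. is_pt n V \<and> P (pt n V)"
    by (intro exI[of _ "idx V x"]) (simp add: is_pt_idx pt_idx)
qed (blast intro: pt_in)

lemma configs_subset: "V \<in> configs \<Longrightarrow> W \<subseteq> V \<Longrightarrow> W \<in> configs"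
  unfolding configs_def mem_Collect_eq by (meson Int_mono finite_subset order_refl)

lemma configs_insert: "V \<in> configs \<Longrightarrow> insert x V \<in> configs"
  unfolding configs_def by (auto simp: Int_insert_left)

section \<open>Measurability of configurations\<close>

lemma space_config_space [simp]: "space config_space = configs"
  unfolding config_space_def by (rule space_measure_of) blast

lemma ecard_ge_iff: "enat k \<le> ecard A \<longleftrightarrow> (\<exists>T. T \<subseteq> A \<and> finite T \<and> card T = k)"
proof (cases "finite A")
  case True
  then have "(\<exists>T. T \<subseteq> A \<and> finite T \<and> card T = k) \<longleftrightarrow> k \<le> card A"
    by (metis card_mono obtain_subset_with_card_n)
  then show ?thesis
    using True by (simp add: ecard_def)
next
  case False
  then show ?thesis
    using infinite_arbitrarily_large[of A k] by (auto simp: ecard_def)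
qed

text \<open>Finitely many points can be separated by disjoint base sets, so the number of points in a
  Borel set is determined by countably many events of the form \<open>V \<inter> B = {}\<close>. These void events form
  a \<open>\<pi>\<close>-system, and their behaviour under insertion of a point is plain; this is why they are
  preferred to the counting events below.\<close>

lemma ecard_ge_iff_hits:
  fixes V :: "'a::polish_space set"
  shows "enat k \<le> ecard (V \<inter> B) \<longleftrightarrow>
     (\<exists>F\<in>{F. finite F \<and> card F = k \<and> disjoint_family_on (base_set :: nat \<Rightarrow> 'a set) F}. \<forall>n\<in>F. V \<inter> (B \<inter> base_set n) \<noteq> {})"
proof
  assume "enat k \<le> ecard (V \<inter> B)"
  then obtain T where T: "T \<subseteq> V \<inter> B" "finite T" "card T = k"
    unfolding ecard_ge_iff by blast
  obtain f where f: "\<And>x. x \<in> T \<Longrightarrow> x \<in> base_set (f x)"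
    and disj: "\<And>x y. x \<in> T \<Longrightarrow> y \<in> T \<Longrightarrow> x \<noteq> y \<Longrightarrow> base_set (f x) \<inter> (base_set (f y) :: 'a set) = {}"
    using finite_separated_by_base_set[OF T(2)] by metis
  have "inj_on f T"
    using f disj unfolding inj_on_def by (metis disjoint_iff)
  then have "card (f ` T) = k"
    using T by (simp add: card_image)
  moreover have "disjoint_family_on (base_set :: nat \<Rightarrow> 'a set) (f ` T)"
    using disj by (auto simp: disjoint_family_on_def)
  moreover have "\<forall>n\<in>f ` T. V \<inter> (B \<inter> base_set n) \<noteq> {}"
    using f T by auto
  ultimately show "\<exists>F\<in>{F. finite F \<and> card F = k \<and> disjoint_family_on (base_set :: nat \<Rightarrow> 'a set) F}.
      \<forall>n\<in>F. V \<inter> (B \<inter> base_set n) \<noteq> {}"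
    using T by (intro bexI[of _ "f ` T"]) auto
next
  assume "\<exists>F\<in>{F. finite F \<and> card F = k \<and> disjoint_family_on (base_set :: nat \<Rightarrow> 'a set) F}. \<forall>n\<in>F. V \<inter> (B \<inter> base_set n) \<noteq> {}"
  then obtain F where F: "finite F" "card F = k" "disjoint_family_on (base_set :: nat \<Rightarrow> 'a set) F"
    "\<And>n. n \<in> F \<Longrightarrow> \<exists>x. x \<in> V \<inter> (B \<inter> base_set n)"
    by blast
  then obtain g where g: "\<And>n. n \<in> F \<Longrightarrow> g n \<in> V \<inter> (B \<inter> base_set n)"
    by metis
  have "inj_on g F"
  proof (rule inj_onI, rule ccontr)
    fix m n assume "m \<in> F" "n \<in> F" "g m = g n" "m \<noteq> n"
    then show False
      using disjoint_family_onD[OF F(3), of m n] g[of m] g[of n] by auto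
  qed
  then have "card (g ` F) = k"
    using F by (simp add: card_image)
  moreover have "g ` F \<subseteq> V \<inter> B"
  proof (rule image_subsetI)
    show "g n \<in> V \<inter> B" if "n \<in> F" for n
      using g[OF that] by simp
  qed
  ultimately show "enat k \<le> ecard (V \<inter> B)"
    unfolding ecard_ge_iff using F(1) by (intro exI[of _ "g ` F"]) simp
qed

lemma enat_le_if_nats_le:
  assumes "\<And>n. enat n \<le> e \<Longrightarrow> enat n \<le> k"
  shows "e \<le> k"
proof (rule ccontr)
  assume "\<not> e \<le> k"
  then have "k < e" by simp
  then obtain m where m: "k = enat m"
    by (cases k) auto
  then have "enat (Suc m) \<le> e"
    using \<open>k < e\<close> by (simp add: Suc_ile_eq)
  from assms[OF this] show False
    by (simp add: m)
qed

lemma enat_eq_iff_nats_le: "e = k \<longleftrightarrow> (\<forall>n. enat n \<le> e \<longleftrightarrow> enat n \<le> k)"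
  using enat_le_if_nats_le[of e k] enat_le_if_nats_le[of k e] order.antisym[of e k] by blast

lemma measurable_configI:
  fixes f :: "'w \<Rightarrow> 'a::polish_space set"
  assumes conf: "\<And>\<omega>. \<omega> \<in> space N \<Longrightarrow> f \<omega> \<in> configs"
    and void: "\<And>B. B \<in> sets borel \<Longrightarrow> Measurable.pred N (\<lambda>\<omega>. f \<omega> \<inter> B = {})"
  shows "f \<in> N \<rightarrow>\<^sub>M config_space"
  unfolding config_space_def
proof (rule measurable_measure_of)
  fix A :: "'a set set"
  assume "A \<in> {{V \<in> configs. ecard (V \<inter> B) = k} |B k. B \<in> sets borel}"
  then obtain B k where A: "A = {V \<in> configs. ecard (V \<inter> B) = k}" and B[measurable]: "B \<in> sets borel"
    by blast
  note void[measurable]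
  have [measurable]: "Measurable.pred N (\<lambda>\<omega>. enat n \<le> ecard (f \<omega> \<inter> B))" for n
    unfolding ecard_ge_iff_hits
  proof -
    let ?D = "disjoint_family_on (base_set :: nat \<Rightarrow> 'a set)"
    \<comment> \<open>Lists, unlike sets, of numbers form a countable type.\<close>
    have "(\<exists>F\<in>{F. finite F \<and> card F = n \<and> ?D F}. P F) \<longleftrightarrow>
        (\<exists>xs\<in>{xs. distinct xs \<and> length xs = n \<and> ?D (set xs)}. P (set xs))" for P
      unfolding Bex_def mem_Collect_eq
      by (metis List.finite_set distinct_card finite_distinct_list)
    then show "Measurable.pred N (\<lambda>\<omega>. \<exists>F\<in>{F. finite F \<and> card F = n \<and> ?D F}.
        \<forall>n\<in>F. f \<omega> \<inter> (B \<inter> base_set n) \<noteq> {})"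
      by simp
  qed
  have "Measurable.pred N (\<lambda>\<omega>. ecard (f \<omega> \<inter> B) = k)"
    unfolding enat_eq_iff_nats_le[of _ k] by measurable
  moreover have "f -` A \<inter> space N = {\<omega>\<in>space N. ecard (f \<omega> \<inter> B) = k}"
    using conf by (auto simp: A)
  ultimately show "f -` A \<inter> space N \<in> sets N"
    by (simp add: pred_def)
qed (use conf in auto)

lemma measurable_config_ecard [measurable (raw)]:
  fixes f :: "'w \<Rightarrow> 'a::polish_space set"
  assumes f: "f \<in> N \<rightarrow>\<^sub>M config_space" and B: "B \<in> sets borel"
  shows "Measurable.pred N (\<lambda>\<omega>. ecard (f \<omega> \<inter> B) = k)"
proof -
  have "{V \<in> configs. ecard (V \<inter> B) = k} \<in> sets config_space"
    unfolding config_space_def using B by (intro in_measure_of) auto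
  then have "{V \<in> space config_space. ecard (V \<inter> B) = k} \<in> sets config_space"
    by simp
  from measurable_sets_Collect[OF f, of "\<lambda>V. ecard (V \<inter> B) = k"] this show ?thesis
    by (simp add: pred_def)
qed

lemma ecard_eq_0_iff: "ecard A = 0 \<longleftrightarrow> A = {}"
  by (auto simp: ecard_def zero_enat_def)

lemma ecard_eq_1_iff: "ecard A = enat 1 \<longleftrightarrow> (\<exists>x. A = {x})"
  by (auto simp: ecard_def card_1_singleton_iff)

lemma measurable_config_void [measurable (raw)]:
  fixes f :: "'w \<Rightarrow> 'a::polish_space set"
  assumes "f \<in> N \<rightarrow>\<^sub>M config_space" and "B \<in> sets borel"
  shows "Measurable.pred N (\<lambda>\<omega>. f \<omega> \<inter> B = {})"
  using measurable_config_ecard[OF assms, of 0] by (simp add: ecard_eq_0_iff)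

lemma measurable_is_pt [measurable (raw)]:
  fixes f :: "'w \<Rightarrow> 'a::polish_space set"
  assumes [measurable]: "f \<in> N \<rightarrow>\<^sub>M config_space"
  shows "Measurable.pred N (\<lambda>\<omega>. is_pt n (f \<omega>))"
proof -
  have *: "is_pt n V \<longleftrightarrow> ecard (V \<inter> base_set n) = enat 1 \<and>
      (\<forall>m<n. \<not> (ecard (V \<inter> base_set m) = enat 1 \<and> \<not> V \<inter> (base_set m \<inter> base_set n) = {}))" for V :: "'a set"
  proof -
    have "V \<inter> base_set m = V \<inter> base_set n \<longleftrightarrow> (\<exists>y. V \<inter> base_set m = {y}) \<and> V \<inter> (base_set m \<inter> base_set n) \<noteq> {}"
      if x: "V \<inter> base_set n = {x}" for x m
    proof (cases "\<exists>y. V \<inter> base_set m = {y}")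
      case True
      then obtain y where y: "V \<inter> base_set m = {y}" ..
      then have "V \<inter> (base_set m \<inter> base_set n) = {y} \<inter> {x}"
        using x by blast
      with x y show ?thesis
        by auto
    qed (use x in simp)
    then show ?thesis
      unfolding is_pt_def ecard_eq_1_iff by (metis (no_types, lifting))
  qed
  show ?thesis
    unfolding * by measurable
qed

lemma measurable_pt [measurable (raw)]:
  fixes f :: "'w \<Rightarrow> 'a::polish_space set"
  assumes f[measurable]: "f \<in> N \<rightarrow>\<^sub>M config_space"
  shows "(\<lambda>\<omega>. pt n (f \<omega>)) \<in> borel_measurable N"
proof (rule measurableI)
  fix A :: "'a set" assume [measurable]: "A \<in> sets borel"
  have *: "(pt n V \<in> A) \<longleftrightarrow> (if is_pt n V then \<not> V \<inter> (base_set n \<inter> A) = {} else undefined \<in> A)" for V :: "'a set"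
  proof (cases "is_pt n V")
    case True
    then have "V \<inter> (base_set n \<inter> A) = {pt n V} \<inter> A"
      using base_set_pt by blast
    with True show ?thesis by simp
  qed (simp add: pt_def)
  have "Measurable.pred N (\<lambda>\<omega>. pt n (f \<omega>) \<in> A)"
    unfolding * by measurable
  then show "(\<lambda>\<omega>. pt n (f \<omega>)) -` A \<inter> space N \<in> sets N"
    by (simp add: pred_def vimage_def Int_def conj_commute)
qed simp

lemma config_bexE:
  fixes f :: "'w \<Rightarrow> 'a::polish_space set"
  assumes "f \<in> N \<rightarrow>\<^sub>M config_space" "\<omega> \<in> space N"
  shows "(\<exists>x\<in>f \<omega>. P x) \<longleftrightarrow> (\<exists>n. is_pt n (f \<omega>) \<and> P (pt n (f \<omega>)))"
  using measurable_space[OF assms] by (intro ex_pt_iff) simp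

lemma measurable_config_bex:
  fixes f :: "'w \<Rightarrow> 'a::polish_space set"
  assumes f[measurable]: "f \<in> N \<rightarrow>\<^sub>M config_space"
    and P[measurable]: "Measurable.pred (N \<Otimes>\<^sub>M borel) (\<lambda>(\<omega>, x). P \<omega> x)"
  shows "Measurable.pred N (\<lambda>\<omega>. \<exists>x\<in>f \<omega>. P \<omega> x)"
proof -
  have "Measurable.pred N (\<lambda>\<omega>. \<exists>n. is_pt n (f \<omega>) \<and> (\<lambda>(\<omega>, x). P \<omega> x) (\<omega>, pt n (f \<omega>)))"
    by measurable
  then show ?thesis
    by (subst measurable_cong[where g = "\<lambda>\<omega>. \<exists>n. is_pt n (f \<omega>) \<and> P \<omega> (pt n (f \<omega>))"])
       (auto simp: config_bexE[OF f])
qed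

lemma measurable_config_ball:
  fixes f :: "'w \<Rightarrow> 'a::polish_space set"
  assumes f[measurable]: "f \<in> N \<rightarrow>\<^sub>M config_space"
    and P[measurable]: "Measurable.pred (N \<Otimes>\<^sub>M borel) (\<lambda>(\<omega>, x). P \<omega> x)"
  shows "Measurable.pred N (\<lambda>\<omega>. \<forall>x\<in>f \<omega>. P \<omega> x)"
proof -
  have [measurable]: "Measurable.pred N (\<lambda>\<omega>. \<exists>x\<in>f \<omega>. \<not> P \<omega> x)"
    by (rule measurable_config_bex[OF f]) (simp add: split_beta')
  have "Measurable.pred N (\<lambda>\<omega>. \<not> (\<exists>x\<in>f \<omega>. \<not> P \<omega> x))"
    by measurable
  then show ?thesis by simp
qed

text \<open>Base sets separate points, so equality is a countable conjunction.\<close>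

lemma measurable_eq_polish [measurable (raw)]:
  fixes f :: "'w \<Rightarrow> 'a::polish_space"
  assumes [measurable]: "f \<in> borel_measurable N" "g \<in> borel_measurable N"
  shows "Measurable.pred N (\<lambda>\<omega>. f \<omega> = g \<omega>)"
proof -
  have *: "x = y \<longleftrightarrow> (\<forall>n. x \<in> base_set n \<longleftrightarrow> y \<in> base_set n)" for x y :: 'a
  proof (cases "x = y")
    case False
    then obtain n where n: "x \<in> base_set n" "base_set n \<subseteq> - {y}"
      by (metis ComplI base_set_nbhd closed_singleton open_Compl singletonD)
    then have "y \<notin> base_set n"
      by auto
    with n(1) False show ?thesis by metis
  qed simp
  show ?thesis
    unfolding * by measurable
qed

lemma measurable_config_mem [measurable (raw)]:
  fixes f :: "'w \<Rightarrow> 'a::polish_space set"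
  assumes f[measurable]: "f \<in> N \<rightarrow>\<^sub>M config_space" and g[measurable]: "g \<in> borel_measurable N"
  shows "Measurable.pred N (\<lambda>\<omega>. g \<omega> \<in> f \<omega>)"
proof -
  have "Measurable.pred N (\<lambda>\<omega>. \<exists>x\<in>f \<omega>. g \<omega> = x)"
    by (rule measurable_config_bex[OF f]) measurable
  then show ?thesis by simp
qed

lemma measurable_config_insert [measurable (raw)]:
  fixes f :: "'w \<Rightarrow> 'a::polish_space set"
  assumes f[measurable]: "f \<in> N \<rightarrow>\<^sub>M config_space" and g[measurable]: "g \<in> borel_measurable N"
  shows "(\<lambda>\<omega>. insert (g \<omega>) (f \<omega>)) \<in> N \<rightarrow>\<^sub>M config_space"
proof (rule measurable_configI)
  show "insert (g \<omega>) (f \<omega>) \<in> configs" if "\<omega> \<in> space N" for \<omega>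
    using measurable_space[OF f that] by (simp add: configs_insert)
  fix B :: "'a set" assume B[measurable]: "B \<in> sets borel"
  have *: "insert x V \<inter> B = {} \<longleftrightarrow> x \<notin> B \<and> V \<inter> B = {}" for x V
    by auto
  show "Measurable.pred N (\<lambda>\<omega>. insert (g \<omega>) (f \<omega>) \<inter> B = {})"
    unfolding * by measurable
qed

text \<open>As the void events are stable under intersection, it will be enough to compare measures on
  configurations on these events.\<close>

lemma sets_config_space_void:
  "sets (config_space :: 'a::polish_space set measure) =
     sigma_sets configs {{V \<in> configs. V \<inter> B = {}} |B. B \<in> sets borel}"
    (is "_ = sigma_sets _ ?E")
proof
  have E: "?E \<subseteq> Pow configs"
    by auto
  have space: "space (sigma configs ?E) = configs" and sets: "sets (sigma configs ?E) = sigma_sets configs ?E"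
    using E by (rule space_measure_of, rule sets_measure_of)
  have *: "(\<lambda>V. V) \<in> sigma configs ?E \<rightarrow>\<^sub>M (config_space :: 'a set measure)"
  proof (rule measurable_configI)
    show "V \<in> configs" if "V \<in> space (sigma configs ?E)" for V
      using that unfolding space .
    fix B :: "'a set" assume "B \<in> sets borel"
    then have "{V \<in> configs. V \<inter> B = {}} \<in> sets (sigma configs ?E)"
      unfolding sets by (intro sigma_sets.Basic) blast
    then show "Measurable.pred (sigma configs ?E) (\<lambda>V. V \<inter> B = {})"
      unfolding pred_def space .
  qed
  show "sets (config_space :: 'a set measure) \<subseteq> sigma_sets configs ?E"
  proof
    fix A :: "'a set set" assume A: "A \<in> sets config_space"
    then have "A \<inter> configs = A"
      using sets.sets_into_space by fastforce
    with measurable_sets[OF * A] show "A \<in> sigma_sets configs ?E"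
      unfolding space sets vimage_ident by simp
  qed
  show "sigma_sets configs ?E \<subseteq> sets (config_space :: 'a set measure)"
  proof (rule sets.sigma_sets_subset'[of _ config_space, simplified])
    show "?E \<subseteq> sets config_space"
    proof clarify
      fix B :: "'a set" assume "B \<in> sets borel"
      then have "{V \<in> space config_space. V \<inter> B = {}} \<in> sets config_space"
        by measurable
      then show "{V \<in> configs. V \<inter> B = {}} \<in> sets config_space"
        by simp
    qed
  qed (metis sets.top space_config_space)
qed

section \<open>Measurability of graphs\<close>

lemma space_graph_space [simp]: "space graph_space = graphs"
  unfolding graph_space_def by (rule space_measure_of) blast

lemma graphsD:
  assumes "\<mu> \<in> graphs"
  shows "verts \<mu> \<in> configs" "(x, y) \<in> adj \<mu> \<Longrightarrow> x \<in> verts \<mu>" "(x, y) \<in> adj \<mu> \<Longrightarrow> y \<in> verts \<mu>"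
    "(x, y) \<in> adj \<mu> \<Longrightarrow> (y, x) \<in> adj \<mu>" "(x, x) \<notin> adj \<mu>"
  using assms by (auto simp: graphs_def sym_def irrefl_def)

lemma neighbours_configs: "\<mu> \<in> graphs \<Longrightarrow> neighbours \<mu> x \<in> configs"
  by (rule configs_subset[OF graphsD(1)]) (auto simp: neighbours_def dest: graphsD(3))

lemma measurable_graph_count:
  fixes A :: "('a::polish_space \<times> 'a set) set"
  assumes "A \<in> sets (borel \<Otimes>\<^sub>M config_space)"
  shows "Measurable.pred graph_space (\<lambda>\<mu>. ecard {x \<in> verts \<mu>. (x, neighbours \<mu> x) \<in> A} = k)"
proof -
  have "{\<mu> \<in> graphs. ecard {x \<in> verts \<mu>. (x, neighbours \<mu> x) \<in> A} = k} \<in> sets graph_space"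
    unfolding graph_space_def using assms by (intro in_measure_of) auto
  then show ?thesis by (simp add: pred_def)
qed

lemma measurable_verts_graph_space:
  "verts \<in> graph_space \<rightarrow>\<^sub>M (config_space :: 'a::polish_space set measure)"
proof (rule measurable_configI)
  fix B :: "'a set" assume [measurable]: "B \<in> sets borel"
  have *: "{x \<in> verts \<mu>. (x, neighbours \<mu> x) \<in> B \<times> configs} = verts \<mu> \<inter> B"
    if "\<mu> \<in> space graph_space" for \<mu> :: "'a graph"
    using that by (auto simp: neighbours_configs)
  have "B \<times> (configs :: 'a set set) \<in> sets (borel \<Otimes>\<^sub>M config_space)"
    using sets.top[of config_space] by auto
  from measurable_graph_count[OF this, of 0]
  have "Measurable.pred graph_space
      (\<lambda>\<mu>. {x \<in> verts \<mu>. (x, neighbours \<mu> x) \<in> B \<times> configs} = {})"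
    unfolding ecard_eq_0_iff .
  then show "Measurable.pred graph_space (\<lambda>\<mu>. verts \<mu> \<inter> B = {})"
    by (subst measurable_cong[OF arg_cong[OF *, of _ "\<lambda>S. S = {}", symmetric]])
qed (simp add: graphsD)

lemma measurable_verts [measurable (raw)]:
  fixes f :: "'w \<Rightarrow> 'a::polish_space graph"
  shows "f \<in> N \<rightarrow>\<^sub>M graph_space \<Longrightarrow> (\<lambda>\<omega>. verts (f \<omega>)) \<in> N \<rightarrow>\<^sub>M config_space"
  using measurable_compose[OF _ measurable_verts_graph_space] .

lemma measurable_adj_pt:
  "Measurable.pred graph_space (\<lambda>\<mu> :: 'a::polish_space graph. is_pt n (verts \<mu>) \<and> is_pt m (verts \<mu>) \<and>
     (pt n (verts \<mu>), pt m (verts \<mu>)) \<in> adj \<mu>)"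
proof -
  \<comment> \<open>Indices \<open>n\<close> and \<open>m\<close> are joined iff a vertex in base set \<open>n\<close> has a neighbour in base set \<open>m\<close>.\<close>
  define A :: "('a \<times> 'a set) set"
    where "A = base_set n \<times> {\<psi> \<in> space config_space. \<not> \<psi> \<inter> base_set m = {}}"
  have "{\<psi> \<in> space config_space. \<not> \<psi> \<inter> (base_set m :: 'a set) = {}} \<in> sets config_space"
    by measurable
  then have A: "A \<in> sets (borel \<Otimes>\<^sub>M config_space)"
    unfolding A_def by (intro pair_measureI) auto
  have *: "(is_pt n (verts \<mu>) \<and> is_pt m (verts \<mu>) \<and> (pt n (verts \<mu>), pt m (verts \<mu>)) \<in> adj \<mu>) \<longleftrightarrow>
      is_pt n (verts \<mu>) \<and> is_pt m (verts \<mu>) \<and>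
      \<not> ecard {x \<in> verts \<mu>. (x, neighbours \<mu> x) \<in> A} = 0"
    if "\<mu> \<in> space graph_space" for \<mu>
  proof (intro conj_cong refl)
    assume n: "is_pt n (verts \<mu>)" and m: "is_pt m (verts \<mu>)"
    have \<mu>: "\<mu> \<in> graphs" using that by simp
    have "x \<in> base_set n \<longleftrightarrow> x = pt n (verts \<mu>)" "x \<in> base_set m \<longleftrightarrow> x = pt m (verts \<mu>)"
      if "x \<in> verts \<mu>" for x
      using base_set_pt[OF n] base_set_pt[OF m] that by blast+
    then have "x \<in> verts \<mu> \<and> (x, neighbours \<mu> x) \<in> A \<longleftrightarrow>
        x = pt n (verts \<mu>) \<and> (x, pt m (verts \<mu>)) \<in> adj \<mu>" for x
      using pt_in[OF n] pt_in[OF m] graphsD(3)[OF \<mu>] neighbours_configs[OF \<mu>]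
      by (auto simp: A_def neighbours_def)
    then show "((pt n (verts \<mu>), pt m (verts \<mu>)) \<in> adj \<mu>) \<longleftrightarrow>
        \<not> ecard {x \<in> verts \<mu>. (x, neighbours \<mu> x) \<in> A} = 0"
      by (simp add: ecard_eq_0_iff)
  qed
  note [measurable] = measurable_graph_count[OF A]
  show ?thesis
    by (subst measurable_cong[OF *]) measurable
qed

text \<open>The \<open>\<sigma>\<close>-algebra on graphs counts the vertices \<open>x\<close> for which \<open>x\<close> together with its neighbours
  lies in a given set. Indexing the vertices reduces this to the vertex set and the countably many
  events that two given indices belong to adjacent vertices.\<close>

lemma measurable_graphI:
  fixes f :: "'w \<Rightarrow> 'a::polish_space graph"
  assumes gr: "\<And>\<omega>. \<omega> \<in> space N \<Longrightarrow> f \<omega> \<in> graphs"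
    and V[measurable]: "(\<lambda>\<omega>. verts (f \<omega>)) \<in> N \<rightarrow>\<^sub>M config_space"
    and E[measurable]: "\<And>n m. Measurable.pred N (\<lambda>\<omega>. is_pt n (verts (f \<omega>)) \<and> is_pt m (verts (f \<omega>)) \<and>
       (pt n (verts (f \<omega>)), pt m (verts (f \<omega>))) \<in> adj (f \<omega>))"
  shows "f \<in> N \<rightarrow>\<^sub>M graph_space"
  unfolding graph_space_def
proof (rule measurable_measure_of)
  define nb where "nb n \<omega> = (if is_pt n (verts (f \<omega>)) then neighbours (f \<omega>) (pt n (verts (f \<omega>))) else {})" for n \<omega>
  have nb[measurable]: "nb n \<in> N \<rightarrow>\<^sub>M config_space" for n
  proof (rule measurable_configI)
    show "nb n \<omega> \<in> configs" if "\<omega> \<in> space N" for \<omega>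
      using neighbours_configs[OF gr[OF that]] by (simp add: nb_def configs_def)
    fix B :: "'a set" assume [measurable]: "B \<in> sets borel"
    have *: "nb n \<omega> \<inter> B = {} \<longleftrightarrow> \<not> (\<exists>m. (is_pt n (verts (f \<omega>)) \<and> is_pt m (verts (f \<omega>)) \<and>
       (pt n (verts (f \<omega>)), pt m (verts (f \<omega>))) \<in> adj (f \<omega>)) \<and> pt m (verts (f \<omega>)) \<in> B)"
      if "\<omega> \<in> space N" for \<omega>
    proof -
      have "nb n \<omega> \<inter> B \<noteq> {} \<longleftrightarrow> is_pt n (verts (f \<omega>)) \<and>
          (\<exists>y\<in>verts (f \<omega>). (pt n (verts (f \<omega>)), y) \<in> adj (f \<omega>) \<and> y \<in> B)"
        using graphsD(3)[OF gr[OF that]] by (auto simp: nb_def neighbours_def)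
      then show ?thesis
        unfolding ex_pt_iff[OF graphsD(1)[OF gr[OF that]]] by blast
    qed
    show "Measurable.pred N (\<lambda>\<omega>. nb n \<omega> \<inter> B = {})"
      by (subst measurable_cong[OF *]) measurable
  qed
  fix S :: "'a graph set"
  assume "S \<in> {{\<mu> \<in> graphs. ecard {x \<in> verts \<mu>. (x, neighbours \<mu> x) \<in> A} = k} |A k.
                    A \<in> sets (borel \<Otimes>\<^sub>M config_space)}"
  then obtain A k where S: "S = {\<mu> \<in> graphs. ecard {x \<in> verts \<mu>. (x, neighbours \<mu> x) \<in> A} = k}"
    and [measurable]: "A \<in> sets (borel \<Otimes>\<^sub>M config_space)"
    by blast
  define W where "W \<omega> = {x \<in> verts (f \<omega>). (x, neighbours (f \<omega>) x) \<in> A}" for \<omega>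
  have [measurable]: "W \<in> N \<rightarrow>\<^sub>M config_space"
  proof (rule measurable_configI)
    show "W \<omega> \<in> configs" if "\<omega> \<in> space N" for \<omega>
      by (rule configs_subset[OF graphsD(1)[OF gr[OF that]]]) (auto simp: W_def)
    fix B :: "'a set" assume [measurable]: "B \<in> sets borel"
    have *: "W \<omega> \<inter> B = {} \<longleftrightarrow> \<not> (\<exists>n. is_pt n (verts (f \<omega>)) \<and>
        (pt n (verts (f \<omega>)), nb n \<omega>) \<in> A \<and> pt n (verts (f \<omega>)) \<in> B)" if "\<omega> \<in> space N" for \<omega>
    proof -
      have "W \<omega> \<inter> B \<noteq> {} \<longleftrightarrow> (\<exists>x\<in>verts (f \<omega>). (x, neighbours (f \<omega>) x) \<in> A \<and> x \<in> B)"
        by (auto simp: W_def)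
      also have "\<dots> \<longleftrightarrow> (\<exists>n. is_pt n (verts (f \<omega>)) \<and>
        (pt n (verts (f \<omega>)), nb n \<omega>) \<in> A \<and> pt n (verts (f \<omega>)) \<in> B)"
        unfolding ex_pt_iff[OF graphsD(1)[OF gr[OF that]]] nb_def by (auto cong: conj_cong)
      finally show ?thesis by blast
    qed
    show "Measurable.pred N (\<lambda>\<omega>. W \<omega> \<inter> B = {})"
      by (subst measurable_cong[OF *]) measurable
  qed
  have "Measurable.pred N (\<lambda>\<omega>. ecard (W \<omega> \<inter> UNIV) = k)"
    by (rule measurable_config_ecard) auto
  moreover have "f -` S \<inter> space N = {\<omega>\<in>space N. ecard (W \<omega> \<inter> UNIV) = k}"
    using gr by (auto simp: S W_def)
  ultimately show "f -` S \<inter> space N \<in> sets N"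
    by (simp add: pred_def)
qed (use gr in auto)

lemma measurable_adj [measurable (raw)]:
  fixes f g :: "'w \<Rightarrow> 'a::polish_space"
  assumes M[measurable]: "M \<in> N \<rightarrow>\<^sub>M graph_space"
    and [measurable]: "f \<in> borel_measurable N" "g \<in> borel_measurable N"
  shows "Measurable.pred N (\<lambda>\<omega>. (f \<omega>, g \<omega>) \<in> adj (M \<omega>))"
proof -
  note [measurable] = measurable_compose[OF M measurable_adj_pt]
  have *: "(f \<omega>, g \<omega>) \<in> adj (M \<omega>) \<longleftrightarrow> (\<exists>n m. (is_pt n (verts (M \<omega>)) \<and> is_pt m (verts (M \<omega>)) \<and>
      (pt n (verts (M \<omega>)), pt m (verts (M \<omega>))) \<in> adj (M \<omega>)) \<and>
      f \<omega> = pt n (verts (M \<omega>)) \<and> g \<omega> = pt m (verts (M \<omega>)))" if "\<omega> \<in> space N" for \<omega>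
  proof -
    have M: "M \<omega> \<in> graphs"
      using measurable_space[OF M that] by simp
    show ?thesis
      using is_pt_idx[OF graphsD(1)[OF M]] pt_idx[OF graphsD(1)[OF M]] graphsD(2,3)[OF M]
      by metis
  qed
  show ?thesis
    by (subst measurable_cong[OF *]) measurable
qed

lemma measurable_delete_vertex [measurable (raw)]:
  fixes f :: "'w \<Rightarrow> 'a::polish_space"
  assumes M[measurable]: "M \<in> N \<rightarrow>\<^sub>M graph_space" and [measurable]: "f \<in> borel_measurable N"
  shows "(\<lambda>\<omega>. delete_vertex (M \<omega>) (f \<omega>)) \<in> N \<rightarrow>\<^sub>M graph_space"
proof (rule measurable_graphI)
  have M': "M \<omega> \<in> graphs" if "\<omega> \<in> space N" for \<omega>
    using measurable_space[OF M that] by simp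
  have conf: "verts (delete_vertex (M \<omega>) (f \<omega>)) \<in> configs" if "\<omega> \<in> space N" for \<omega>
    by (rule configs_subset[OF graphsD(1)[OF M'[OF that]]]) (simp add: delete_vertex_def induced_def)
  show "delete_vertex (M \<omega>) (f \<omega>) \<in> graphs" if "\<omega> \<in> space N" for \<omega>
    using conf[OF that] M'[OF that]
    by (auto simp: graphs_def delete_vertex_def induced_def sym_def irrefl_def)
  show [measurable]: "(\<lambda>\<omega>. verts (delete_vertex (M \<omega>) (f \<omega>))) \<in> N \<rightarrow>\<^sub>M config_space"
  proof (rule measurable_configI[OF conf])
    fix B :: "'a set" assume [measurable]: "B \<in> sets borel"
    have [measurable]: "Measurable.pred N (\<lambda>\<omega>. \<exists>y\<in>verts (M \<omega>). y \<noteq> f \<omega> \<and> y \<in> B)"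
      by (rule measurable_config_bex) measurable
    have *: "verts (delete_vertex (M \<omega>) (f \<omega>)) \<inter> B = {} \<longleftrightarrow>
        \<not> (\<exists>y\<in>verts (M \<omega>). y \<noteq> f \<omega> \<and> y \<in> B)" for \<omega>
      by (auto simp: delete_vertex_def induced_def)
    show "Measurable.pred N (\<lambda>\<omega>. verts (delete_vertex (M \<omega>) (f \<omega>)) \<inter> B = {})"
      unfolding * by measurable
  qed
  have *: "(x, y) \<in> adj (delete_vertex (M \<omega>) (f \<omega>)) \<longleftrightarrow> (x, y) \<in> adj (M \<omega>) \<and> x \<noteq> f \<omega> \<and> y \<noteq> f \<omega>" for \<omega> x y
    by (auto simp: delete_vertex_def induced_def)
  show "Measurable.pred N (\<lambda>\<omega>. is_pt n (verts (delete_vertex (M \<omega>) (f \<omega>))) \<and>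
      is_pt m (verts (delete_vertex (M \<omega>) (f \<omega>))) \<and>
      (pt n (verts (delete_vertex (M \<omega>) (f \<omega>))), pt m (verts (delete_vertex (M \<omega>) (f \<omega>))))
        \<in> adj (delete_vertex (M \<omega>) (f \<omega>)))" for n m
    unfolding * by measurable
qed

lemma measurable_adj_relpow:
  "Measurable.pred ((borel \<Otimes>\<^sub>M borel) \<Otimes>\<^sub>M graph_space)
     (\<lambda>((x, y), \<mu>). (x, y) \<in> adj (\<mu> :: 'a::polish_space graph) ^^ n)"
proof (induction n)
  case 0
  have "Measurable.pred ((borel \<Otimes>\<^sub>M borel) \<Otimes>\<^sub>M graph_space) (\<lambda>\<omega>. fst (fst \<omega>) = (snd (fst \<omega>) :: 'a))"
    by measurable
  then show ?case by (simp add: split_beta')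
next
  case (Suc n)
  let ?S = "(borel \<Otimes>\<^sub>M borel) \<Otimes>\<^sub>M (graph_space :: 'a graph measure)"
  have meas: "Measurable.pred ?S (\<lambda>\<omega>. \<exists>z\<in>verts (snd \<omega>).
      (fst (fst \<omega>), z) \<in> adj (snd \<omega>) ^^ n \<and> (z, snd (fst \<omega>)) \<in> adj (snd \<omega>))"
  proof (rule measurable_config_bex)
    have [measurable]: "Measurable.pred (?S \<Otimes>\<^sub>M borel) (\<lambda>(\<omega>, z). (fst (fst \<omega>), z) \<in> adj (snd \<omega>) ^^ n)"
    proof -
      have "(\<lambda>(\<omega>, z). ((fst (fst \<omega>), z), snd \<omega>)) \<in> ?S \<Otimes>\<^sub>M borel \<rightarrow>\<^sub>M ?S"
        by measurable
      from measurable_compose[OF this Suc.IH] show ?thesis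
        by (simp add: split_beta')
    qed
    show "Measurable.pred (?S \<Otimes>\<^sub>M borel) (\<lambda>(\<omega>, z).
      (fst (fst \<omega>), z) \<in> adj (snd \<omega>) ^^ n \<and> (z, snd (fst \<omega>)) \<in> adj (snd \<omega>))"
      by measurable
  qed measurable
  have eq: "(\<lambda>((x, y), \<mu>). (x, y) \<in> adj \<mu> ^^ Suc n) \<omega> \<longleftrightarrow>
      (\<exists>z\<in>verts (snd \<omega>). (fst (fst \<omega>), z) \<in> adj (snd \<omega>) ^^ n \<and> (z, snd (fst \<omega>)) \<in> adj (snd \<omega>))"
    if "\<omega> \<in> space ?S" for \<omega>
  proof -
    have "snd \<omega> \<in> graphs"
      using that by (auto simp: space_pair_measure)
    from graphsD(2)[OF this] show ?thesis
      unfolding split_beta' relpow.simps relcomp_unfold by (simp add: Bex_def) blast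
  qed
  show ?case
    by (rule iffD1[OF measurable_cong[OF eq[symmetric]] meas])
qed

lemma measurable_connected_in [measurable (raw)]:
  fixes f g :: "'w \<Rightarrow> 'a::polish_space"
  assumes M[measurable]: "M \<in> N \<rightarrow>\<^sub>M graph_space"
    and [measurable]: "f \<in> borel_measurable N" "g \<in> borel_measurable N"
  shows "Measurable.pred N (\<lambda>\<omega>. connected_in (M \<omega>) (f \<omega>) (g \<omega>))"
proof -
  have [measurable]: "Measurable.pred N (\<lambda>\<omega>. (f \<omega>, g \<omega>) \<in> adj (M \<omega>) ^^ n)" for n
  proof -
    have "(\<lambda>\<omega>. ((f \<omega>, g \<omega>), M \<omega>)) \<in> N \<rightarrow>\<^sub>M (borel \<Otimes>\<^sub>M borel) \<Otimes>\<^sub>M graph_space"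
      by measurable
    from measurable_compose[OF this measurable_adj_relpow[of n]] show ?thesis
      by simp
  qed
  show ?thesis
    unfolding connected_in_def rtrancl_power by measurable
qed

section \<open>Infinite clusters\<close>

lemma connected_in_sym:
  assumes "\<mu> \<in> graphs" "connected_in \<mu> x y"
  shows "connected_in \<mu> y x"
proof -
  have "sym ((adj \<mu>)\<^sup>*)"
    using assms(1) by (intro sym_rtrancl) (simp add: graphs_def)
  then show ?thesis
    using assms(2) by (auto simp: connected_in_def dest: symD)
qed

lemma connected_in_trans:
  "connected_in \<mu> x y \<Longrightarrow> connected_in \<mu> y z \<Longrightarrow> connected_in \<mu> x z"
  by (auto simp: connected_in_def)

lemma connected_in_refl: "x \<in> verts \<mu> \<Longrightarrow> connected_in \<mu> x x"
  by (simp add: connected_in_def)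

lemma connected_in_adj: "\<mu> \<in> graphs \<Longrightarrow> (x, y) \<in> adj \<mu> \<Longrightarrow> connected_in \<mu> x y"
  by (auto simp: connected_in_def graphsD)

lemma connected_in_mono:
  assumes "connected_in \<mu> x y" "verts \<mu> \<subseteq> verts \<nu>" "adj \<mu> \<subseteq> adj \<nu>"
  shows "connected_in \<nu> x y"
  using assms rtrancl_mono[OF assms(3)] by (auto simp: connected_in_def)

lemma induced_graphs: "\<mu> \<in> graphs \<Longrightarrow> induced \<mu> W \<in> graphs"
  by (auto simp: graphs_def induced_def sym_def irrefl_def intro: configs_subset)

lemma verts_component: "verts (component x \<mu>) = {y. connected_in \<mu> x y}"
  by (auto simp: component_def induced_def connected_in_def)

definition in_infinite_cluster :: "'a graph \<Rightarrow> 'a \<Rightarrow> bool" where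
  "in_infinite_cluster \<mu> x \<longleftrightarrow> infinite {y. connected_in \<mu> x y}"

text \<open>The first two conjuncts make \<open>x\<close> and \<open>y\<close> vertices.\<close>

definition separated :: "'a graph \<Rightarrow> 'a \<Rightarrow> 'a \<Rightarrow> bool" where
  "separated \<mu> x y \<longleftrightarrow>
     in_infinite_cluster \<mu> x \<and> in_infinite_cluster \<mu> y \<and> \<not> connected_in \<mu> x y"

text \<open>For a graph this is \<open>N_inf x \<mu> \<ge> 2\<close>, see \<open>N_inf_ge_2_iff\<close>, expressed by vertices in place
  of clusters.\<close>

definition splits :: "'a \<Rightarrow> 'a graph \<Rightarrow> bool" where
  "splits x \<mu> \<longleftrightarrow> (\<exists>y\<in>verts \<mu>. \<exists>z\<in>verts \<mu>. connected_in \<mu> x y \<and> connected_in \<mu> x z \<and>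
     separated (delete_vertex \<mu> x) y z)"

lemma in_infinite_cluster_verts: "in_infinite_cluster \<mu> x \<Longrightarrow> x \<in> verts \<mu>"
  by (auto simp: in_infinite_cluster_def connected_in_def intro: ccontr)

lemma in_infinite_cluster_mono:
  assumes "in_infinite_cluster \<mu> x" "verts \<mu> \<subseteq> verts \<nu>" "adj \<mu> \<subseteq> adj \<nu>"
  shows "in_infinite_cluster \<nu> x"
  using assms(1) unfolding in_infinite_cluster_def
  by (rule infinite_super[rotated]) (auto intro: connected_in_mono[OF _ assms(2,3)])

lemma in_infinite_cluster_connected:
  assumes "connected_in \<mu> x y" "in_infinite_cluster \<mu> y"
  shows "in_infinite_cluster \<mu> x"
  using assms(2) unfolding in_infinite_cluster_def
  by (rule infinite_super[rotated]) (auto intro: connected_in_trans[OF assms(1)])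

lemma not_separated_refl: "\<not> separated \<mu> x x"
  using in_infinite_cluster_verts[of \<mu> x] connected_in_refl[of x \<mu>] by (auto simp: separated_def)

lemma component_eq_iff:
  assumes "\<mu> \<in> graphs" "y \<in> verts \<mu>"
  shows "component x \<mu> = component y \<mu> \<longleftrightarrow> connected_in \<mu> x y"
proof
  assume "component x \<mu> = component y \<mu>"
  then have "{z. connected_in \<mu> x z} = {z. connected_in \<mu> y z}"
    using verts_component by metis
  then show "connected_in \<mu> x y"
    using connected_in_refl[OF assms(2)] by blast
next
  assume "connected_in \<mu> x y"
  then have "{z. connected_in \<mu> x z} = {z. connected_in \<mu> y z}"
    using connected_in_sym[OF assms(1)] by (auto intro: connected_in_trans)
  then show "component x \<mu> = component y \<mu>"
    by (simp add: component_def)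
qed

lemma two_le_ecard_iff: "2 \<le> ecard A \<longleftrightarrow> (\<exists>a\<in>A. \<exists>b\<in>A. a \<noteq> b)"
proof -
  have "2 \<le> ecard A \<longleftrightarrow> (\<exists>T. T \<subseteq> A \<and> finite T \<and> card T = 2)"
    using ecard_ge_iff[of 2 A] by (simp add: numeral_eq_enat)
  also have "\<dots> \<longleftrightarrow> (\<exists>a\<in>A. \<exists>b\<in>A. a \<noteq> b)"
  proof
    assume "\<exists>T. T \<subseteq> A \<and> finite T \<and> card T = 2"
    then show "\<exists>a\<in>A. \<exists>b\<in>A. a \<noteq> b"
      by (auto simp: card_2_iff)
  next
    assume "\<exists>a\<in>A. \<exists>b\<in>A. a \<noteq> b"
    then obtain a b where "a \<in> A" "b \<in> A" "a \<noteq> b" by blast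
    then show "\<exists>T. T \<subseteq> A \<and> finite T \<and> card T = 2"
      by (intro exI[of _ "{a, b}"]) auto
  qed
  finally show ?thesis .
qed

lemma enat_le_1_iff: "(e :: enat) \<le> 1 \<longleftrightarrow> \<not> 2 \<le> e"
  by (cases e) (auto simp: numeral_eq_enat one_enat_def)

lemma two_le_infinite_clusters_iff:
  assumes "\<mu> \<in> graphs"
  shows "2 \<le> ecard (infinite_clusters \<mu>) \<longleftrightarrow> (\<exists>x\<in>verts \<mu>. \<exists>y\<in>verts \<mu>. separated \<mu> x y)"
proof -
  have "infinite_clusters \<mu> = (\<lambda>x. component x \<mu>) ` {x. in_infinite_cluster \<mu> x}"
    unfolding infinite_clusters_def verts_component in_infinite_cluster_def[symmetric]
    using in_infinite_cluster_verts[of \<mu>] by blast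
  then have "2 \<le> ecard (infinite_clusters \<mu>) \<longleftrightarrow>
      (\<exists>x y. in_infinite_cluster \<mu> x \<and> in_infinite_cluster \<mu> y \<and> component x \<mu> \<noteq> component y \<mu>)"
    by (simp add: two_le_ecard_iff)
  also have "\<dots> \<longleftrightarrow> (\<exists>x\<in>verts \<mu>. \<exists>y\<in>verts \<mu>. separated \<mu> x y)"
    using component_eq_iff[OF assms] in_infinite_cluster_verts unfolding separated_def by metis
  finally show ?thesis .
qed

lemma delete_vertex_graphs: "\<mu> \<in> graphs \<Longrightarrow> delete_vertex \<mu> x \<in> graphs"
  unfolding delete_vertex_def by (rule induced_graphs)

lemma delete_vertex_subset:
  "verts (delete_vertex \<mu> x) \<subseteq> verts \<mu>" "x \<notin> verts (delete_vertex \<mu> x)"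
  "adj (delete_vertex \<mu> x) \<subseteq> adj \<mu>"
  by (auto simp: delete_vertex_def induced_def)

text \<open>A path that avoids \<open>x\<close> and starts in the component of \<open>x\<close> never leaves this component; so the
  clusters of the component without \<open>x\<close> are clusters of the graph without \<open>x\<close>.\<close>

lemma connected_in_delete_component:
  assumes \<mu>: "\<mu> \<in> graphs" and "connected_in \<mu> x y"
  shows "connected_in (delete_vertex (component x \<mu>) x) y z \<longleftrightarrow> connected_in (delete_vertex \<mu> x) y z"
proof
  assume "connected_in (delete_vertex (component x \<mu>) x) y z"
  then show "connected_in (delete_vertex \<mu> x) y z"
    by (rule connected_in_mono) (auto simp: delete_vertex_def component_def induced_def)
next
  let ?H = "delete_vertex (component x \<mu>) x"
  assume *: "connected_in (delete_vertex \<mu> x) y z"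
  then have "(y, z) \<in> (adj (delete_vertex \<mu> x))\<^sup>*"
    by (simp add: connected_in_def)
  then have "connected_in \<mu> x z \<and> (y, z) \<in> (adj ?H)\<^sup>*"
  proof induction
    case base
    show ?case using assms by simp
  next
    case (step u v)
    then have uv: "(u, v) \<in> adj \<mu>" "u \<noteq> x" "v \<noteq> x" "connected_in \<mu> x u"
      by (auto simp: delete_vertex_def induced_def)
    then have v: "connected_in \<mu> x v"
      by (auto intro: connected_in_trans connected_in_adj[OF \<mu>])
    with uv have "(u, v) \<in> adj ?H"
      by (auto simp: delete_vertex_def induced_def component_def)
    with step v show ?case by auto
  qed
  moreover have "z \<in> verts \<mu>" "y \<in> verts \<mu>" "y \<noteq> x" "z \<noteq> x"
    using * by (auto simp: connected_in_def delete_vertex_def induced_def)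
  moreover have "v \<in> verts ?H \<longleftrightarrow> connected_in \<mu> x v \<and> v \<noteq> x" for v
    by (auto simp: delete_vertex_def induced_def verts_component)
  ultimately show "connected_in ?H y z"
    using assms unfolding connected_in_def[of ?H] by simp
qed

lemma N_inf_ge_2_iff:
  assumes "\<mu> \<in> graphs"
  shows "2 \<le> N_inf x \<mu> \<longleftrightarrow> splits x \<mu>"
proof -
  let ?H = "delete_vertex (component x \<mu>) x"
  have H: "?H \<in> graphs"
    using assms by (simp add: delete_vertex_graphs component_def induced_graphs)
  have verts: "y \<in> verts ?H \<longleftrightarrow> connected_in \<mu> x y \<and> y \<noteq> x" for y
    by (auto simp: delete_vertex_def induced_def verts_component)
  have "separated ?H y z \<longleftrightarrow> separated (delete_vertex \<mu> x) y z"
    if "connected_in \<mu> x y" "connected_in \<mu> x z" for y z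
    using that by (simp add: separated_def in_infinite_cluster_def connected_in_delete_component[OF assms])
  moreover have "y \<noteq> x \<and> z \<noteq> x" if "separated (delete_vertex \<mu> x) y z" for y z
    using that delete_vertex_subset(2)[of x \<mu>] in_infinite_cluster_verts[of "delete_vertex \<mu> x"]
    unfolding separated_def by blast
  moreover have "y \<in> verts \<mu>" if "connected_in \<mu> x y" for y
    using that by (simp add: connected_in_def)
  ultimately show ?thesis
    unfolding N_inf_def two_le_infinite_clusters_iff[OF H] splits_def Bex_def verts by blast
qed

lemma splits_imp_separated:
  "splits x \<mu> \<Longrightarrow> \<exists>y\<in>verts (delete_vertex \<mu> x). \<exists>z\<in>verts (delete_vertex \<mu> x). separated (delete_vertex \<mu> x) y z"
  unfolding splits_def separated_def using in_infinite_cluster_verts[of "delete_vertex \<mu> x"] by blast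

text \<open>A vertex \<open>z\<close> with a neighbour in one infinite cluster joins this cluster; if it also met
  another one, then its deletion would split the two.\<close>

lemma separated_by_added_vertex:
  assumes \<mu>: "\<mu> \<in> graphs" and "\<not> splits z \<mu>"
    and sep: "separated (delete_vertex \<mu> z) x y" and adj: "(z, x) \<in> adj \<mu>"
  shows "separated \<mu> z y" "(z, y) \<notin> adj \<mu>"
proof -
  have inf: "in_infinite_cluster (delete_vertex \<mu> z) x" "in_infinite_cluster (delete_vertex \<mu> z) y"
    using sep by (auto simp: separated_def)
  then have inf': "in_infinite_cluster \<mu> x" "in_infinite_cluster \<mu> y"
    by (auto intro: in_infinite_cluster_mono[OF _ delete_vertex_subset(1,3)])
  have zx: "connected_in \<mu> z x"
    by (rule connected_in_adj[OF \<mu> adj])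
  have zy: "\<not> connected_in \<mu> z y"
    using zx sep assms(2) in_infinite_cluster_verts[OF inf'(1)] in_infinite_cluster_verts[OF inf'(2)]
    unfolding splits_def by blast
  show "separated \<mu> z y"
    unfolding separated_def using in_infinite_cluster_connected[OF zx inf'(1)] inf'(2) zy by blast
  show "(z, y) \<notin> adj \<mu>"
    using zy connected_in_adj[OF \<mu>] by blast
qed

lemma connected_in_crossing_edge:
  assumes "connected_in \<mu> x y" "P x" "\<not> P y"
  obtains u v where "(u, v) \<in> adj \<mu>" "P u" "\<not> P v"
proof -
  have "(x, y) \<in> (adj \<mu>)\<^sup>*"
    using assms(1) by (simp add: connected_in_def)
  then have "P y \<or> (\<exists>u v. (u, v) \<in> adj \<mu> \<and> P u \<and> \<not> P v)"
    by induction (use assms(2) in auto)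
  then show thesis
    using that assms(3) by blast
qed

lemma measurable_in_infinite_cluster [measurable (raw)]:
  fixes f :: "'w \<Rightarrow> 'a::polish_space"
  assumes M[measurable]: "M \<in> N \<rightarrow>\<^sub>M graph_space" and [measurable]: "f \<in> borel_measurable N"
  shows "Measurable.pred N (\<lambda>\<omega>. in_infinite_cluster (M \<omega>) (f \<omega>))"
proof -
  have *: "in_infinite_cluster (M \<omega>) (f \<omega>) \<longleftrightarrow>
      (\<forall>k. \<exists>n. k \<le> n \<and> is_pt n (verts (M \<omega>)) \<and> connected_in (M \<omega>) (f \<omega>) (pt n (verts (M \<omega>))))"
    if "\<omega> \<in> space N" for \<omega>
  proof -
    let ?V = "verts (M \<omega>)"
    define I where "I = {n. is_pt n ?V \<and> connected_in (M \<omega>) (f \<omega>) (pt n ?V)}"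
    have V: "?V \<in> configs"
      using measurable_space[OF M that] by (simp add: graphsD)
    \<comment> \<open>Infinitely many vertices means infinitely many indices, which is a countable condition.\<close>
    have "{y. connected_in (M \<omega>) (f \<omega>) y} = (\<lambda>n. pt n ?V) ` I"
    proof (rule set_eqI)
      show "y \<in> {y. connected_in (M \<omega>) (f \<omega>) y} \<longleftrightarrow> y \<in> (\<lambda>n. pt n ?V) ` I" for y
        using is_pt_idx[OF V, of y] pt_idx[OF V, of y]
        by (auto simp: I_def connected_in_def intro!: image_eqI[of y _ "idx ?V y"])
    qed
    moreover have "inj_on (\<lambda>n. pt n ?V) I"
      by (rule inj_on_inverseI[where g = "idx ?V"]) (simp add: I_def idx_pt)
    ultimately have "in_infinite_cluster (M \<omega>) (f \<omega>) \<longleftrightarrow> infinite I"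
      by (simp add: in_infinite_cluster_def finite_image_iff)
    then show ?thesis
      by (simp add: infinite_nat_iff_unbounded_le I_def)
  qed
  show ?thesis
    by (subst measurable_cong[OF *]) measurable
qed

lemma measurable_separated [measurable (raw)]:
  fixes f g :: "'w \<Rightarrow> 'a::polish_space"
  assumes [measurable]: "M \<in> N \<rightarrow>\<^sub>M graph_space" "f \<in> borel_measurable N" "g \<in> borel_measurable N"
  shows "Measurable.pred N (\<lambda>\<omega>. separated (M \<omega>) (f \<omega>) (g \<omega>))"
  unfolding separated_def by measurable

lemma measurable_splits [measurable (raw)]:
  fixes f :: "'w \<Rightarrow> 'a::polish_space"
  assumes [measurable]: "M \<in> N \<rightarrow>\<^sub>M graph_space" "f \<in> borel_measurable N"
  shows "Measurable.pred N (\<lambda>\<omega>. splits (f \<omega>) (M \<omega>))"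
  unfolding splits_def
proof (rule measurable_config_bex)
  show "Measurable.pred (N \<Otimes>\<^sub>M borel) (\<lambda>(\<omega>, y). \<exists>z\<in>verts (M \<omega>). connected_in (M \<omega>) (f \<omega>) y \<and>
      connected_in (M \<omega>) (f \<omega>) z \<and> separated (delete_vertex (M \<omega>) (f \<omega>)) y z)"
    unfolding split_beta' by (rule measurable_config_bex) measurable
qed measurable

lemma measurable_ex_separated [measurable (raw)]:
  fixes M :: "'w \<Rightarrow> 'a::polish_space graph"
  assumes [measurable]: "M \<in> N \<rightarrow>\<^sub>M graph_space"
  shows "Measurable.pred N (\<lambda>\<omega>. \<exists>x\<in>verts (M \<omega>). \<exists>y\<in>verts (M \<omega>). separated (M \<omega>) x y)"
proof (rule measurable_config_bex)
  show "Measurable.pred (N \<Otimes>\<^sub>M borel) (\<lambda>(\<omega>, x). \<exists>y\<in>verts (M \<omega>). separated (M \<omega>) x y)"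
    unfolding split_beta' by (rule measurable_config_bex) measurable
qed measurable

section \<open>The kernel of the random connection model\<close>

lemma emeasure_uniform_less:
  fixes p :: real
  assumes "0 \<le> p" "p \<le> 1"
  shows "emeasure (uniform_measure lborel {0..1}) {r. (r < p) \<in> F} = emeasure (measure_pmf (bernoulli_pmf p)) F"
proof -
  have T: "emeasure (uniform_measure lborel {0..1}) {r. r < p} = ennreal p"
  proof -
    have "{0..1} \<inter> {r. r < p} = {0..<p}"
      using assms by auto
    then show ?thesis
      using assms by (simp add: divide_ennreal_def)
  qed
  have F: "emeasure (uniform_measure lborel {0..1}) {r. \<not> r < p} = ennreal (1 - p)"
  proof -
    have "{0..1} \<inter> {r. \<not> r < p} = {p..1}"
      using assms by auto
    then show ?thesis
      using assms by (simp add: divide_ennreal_def)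
  qed
  have U: "emeasure (uniform_measure lborel {0..1::real}) UNIV = 1"
    by (simp add: divide_ennreal_def)
  consider "F = {}" | "F = {True}" | "F = {False}" | "F = UNIV"
    using Pow_UNIV[where 'a = bool] UNIV_bool by (metis (full_types) UNIV_eq_I insertI1 is_singletonI' is_singleton_the_elem singletonD)
  then show ?thesis
  proof cases
    case 1
    then show ?thesis by simp
  next
    case 2
    then show ?thesis using T assms by (simp add: emeasure_pmf_single)
  next
    case 3
    then show ?thesis using F assms by (simp add: emeasure_pmf_single)
  next
    case 4
    then show ?thesis using U by (simp add: measure_pmf.emeasure_space_1[simplified])
  qed
qed

lemma graph_of_graphs: "V \<in> configs \<Longrightarrow> graph_of V s \<in> graphs"
  by (auto simp: graphs_def graph_of_def sym_def irrefl_def insert_commute)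

lemma verts_graph_of [simp]: "verts (graph_of V s) = V"
  by (simp add: graph_of_def)

lemma adj_graph_of: "(x, y) \<in> adj (graph_of V s) \<longleftrightarrow> x \<in> V \<and> y \<in> V \<and> x \<noteq> y \<and> s {x, y}"
  by (simp add: graph_of_def)

lemma pairsI: "x \<in> V \<Longrightarrow> y \<in> V \<Longrightarrow> x \<noteq> y \<Longrightarrow> {x, y} \<in> pairs V"
  by (auto simp: pairs_def)

lemma pairsE:
  assumes "e \<in> pairs V"
  obtains x y where "e = {x, y}" "x \<in> V" "y \<in> V" "x \<noteq> y"
  using assms by (auto simp: pairs_def)

lemma pairs_mono: "W \<subseteq> V \<Longrightarrow> pairs W \<subseteq> pairs V"
  by (auto simp: pairs_def)

lemma graph_of_cong: "(\<And>e. e \<in> pairs V \<Longrightarrow> s e = t e) \<Longrightarrow> graph_of V s = graph_of V t"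
  unfolding graph_of_def by (auto simp: pairsI)

definition edge_law :: "('a \<Rightarrow> 'a \<Rightarrow> real) \<Rightarrow> 'a set \<Rightarrow> ('a set \<Rightarrow> bool) measure" where
  "edge_law \<phi> V = (\<Pi>\<^sub>M e\<in>pairs V. measure_pmf (bernoulli_pmf (edge_prob \<phi> e)))"

lemma sets_edge_law [measurable_cong]:
  "sets (edge_law \<phi> V) = sets (\<Pi>\<^sub>M e\<in>pairs V. count_space UNIV)"
  unfolding edge_law_def by (intro sets_PiM_cong) auto

lemma space_edge_law: "space (edge_law \<phi> V) = (\<Pi>\<^sub>E e\<in>pairs V. UNIV)"
  by (simp add: edge_law_def space_PiM)

lemma prob_space_edge_law: "prob_space (edge_law \<phi> V)"
  unfolding edge_law_def by (intro prob_space_PiM measure_pmf.prob_space_axioms)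

lemma measurable_graph_of:
  fixes V :: "'a::polish_space set"
  assumes V: "V \<in> configs"
  shows "graph_of V \<in> edge_law \<phi> V \<rightarrow>\<^sub>M graph_space"
proof (rule measurable_graphI)
  show "graph_of V s \<in> graphs" for s
    by (rule graph_of_graphs[OF V])
  show "(\<lambda>s. verts (graph_of V s)) \<in> edge_law \<phi> V \<rightarrow>\<^sub>M config_space"
    using V by simp
  fix n m
  show "Measurable.pred (edge_law \<phi> V) (\<lambda>s. is_pt n (verts (graph_of V s)) \<and> is_pt m (verts (graph_of V s)) \<and>
      (pt n (verts (graph_of V s)), pt m (verts (graph_of V s))) \<in> adj (graph_of V s))"
  proof (cases "is_pt n V \<and> is_pt m V \<and> pt n V \<noteq> pt m V")
    case True
    then have "{pt n V, pt m V} \<in> pairs V"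
      by (auto intro: pairsI pt_in)
    then have "(\<lambda>s. s {pt n V, pt m V}) \<in> edge_law \<phi> V \<rightarrow>\<^sub>M count_space UNIV"
      by (simp cong: measurable_cong_sets[OF sets_edge_law refl])
    with True show ?thesis
      by (simp add: adj_graph_of pt_in)
  next
    case False
    then have "\<not> (is_pt n V \<and> is_pt m V \<and> (pt n V, pt m V) \<in> adj (graph_of V s))" for s
      by (auto simp: adj_graph_of)
    then show ?thesis
      by (simp only: verts_graph_of) simp
  qed
qed

lemma rcm_kernel_eq: "rcm_kernel \<phi> V = distr (edge_law \<phi> V) graph_space (graph_of V)"
  by (simp add: rcm_kernel_def edge_law_def)

lemma sets_rcm_kernel [simp, measurable_cong]: "sets (rcm_kernel \<phi> V) = sets graph_space"
  by (simp add: rcm_kernel_eq)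

lemma space_rcm_kernel [simp]: "space (rcm_kernel \<phi> V) = graphs"
  by (simp add: rcm_kernel_eq)

lemma AE_rcm_kernel_iff:
  fixes V :: "'a::polish_space set"
  assumes "V \<in> configs" and [measurable]: "Measurable.pred graph_space P"
  shows "(AE \<mu> in rcm_kernel \<phi> V. P \<mu>) \<longleftrightarrow> (AE s in edge_law \<phi> V. P (graph_of V s))"
  unfolding rcm_kernel_eq by (intro AE_distr_iff measurable_graph_of assms(1)) measurable

text \<open>The vertex set is countable, so the quantifier may be moved across the almost sure statement.\<close>

lemma AE_rcm_kernel_ball_verts:
  fixes V :: "'a::polish_space set"
  assumes V: "V \<in> configs" and P: "\<And>x. x \<in> V \<Longrightarrow> AE \<mu> in rcm_kernel \<phi> V. P x \<mu>"
    and meas: "\<And>x. Measurable.pred graph_space (P x)"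
      "Measurable.pred graph_space (\<lambda>\<mu>. \<forall>x\<in>verts \<mu>. P x \<mu>)"
  shows "AE \<mu> in rcm_kernel \<phi> V. \<forall>x\<in>verts \<mu>. P x \<mu>"
proof -
  have "AE s in edge_law \<phi> V. \<forall>x\<in>V. P x (graph_of V s)"
    unfolding AE_ball_countable[OF countable_configs[OF V]]
    using P AE_rcm_kernel_iff[OF V meas(1)] by blast
  then show ?thesis
    by (simp add: AE_rcm_kernel_iff[OF V meas(2)])
qed

locale connection =
  fixes \<phi> :: "'a::polish_space \<Rightarrow> 'a \<Rightarrow> real"
  assumes measurable_connection: "(\<lambda>(x, y). \<phi> x y) \<in> borel_measurable (borel \<Otimes>\<^sub>M borel)"
    and connection_nonneg: "0 \<le> \<phi> x y" and connection_le_1: "\<phi> x y \<le> 1"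
    and connection_sym: "\<phi> x y = \<phi> y x"
begin

lemma measurable_\<phi> [measurable (raw)]:
  assumes [measurable]: "f \<in> borel_measurable N" "g \<in> borel_measurable N"
  shows "(\<lambda>\<omega>. \<phi> (f \<omega>) (g \<omega>)) \<in> borel_measurable N"
proof -
  have "(\<lambda>\<omega>. (f \<omega>, g \<omega>)) \<in> N \<rightarrow>\<^sub>M borel \<Otimes>\<^sub>M borel"
    by measurable
  from measurable_compose[OF this measurable_connection] show ?thesis
    by simp
qed

lemma edge_prob_pair [simp]: "edge_prob \<phi> {x, y} = \<phi> x y"
  unfolding edge_prob_def
proof (rule the_equality)
  show "p = \<phi> x y" if "\<exists>x' y'. {x, y} = {x', y'} \<and> p = \<phi> x' y'" for p
    using that connection_sym by (auto simp: doubleton_eq_iff)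
qed blast

lemma edge_prob_bounds:
  assumes "e \<in> pairs V"
  shows "0 \<le> edge_prob \<phi> e" "edge_prob \<phi> e \<le> 1"
  using assms by (auto elim!: pairsE simp: connection_nonneg connection_le_1)

text \<open>The product space of the edge indicators changes with the vertices. To see that the kernel is
  measurable, all graphs are therefore built from the same independent uniform marks: the points with
  indices \<open>n\<close> and \<open>m\<close> are joined if the mark of the set \<open>{n, m}\<close> is smaller than their edge
  probability.\<close>

definition marks :: "(nat set \<Rightarrow> real) measure" where
  "marks = (\<Pi>\<^sub>M i\<in>UNIV. uniform_measure lborel {0..1})"

definition marked_graph :: "'a set \<Rightarrow> (nat set \<Rightarrow> real) \<Rightarrow> 'a graph" where
  "marked_graph V u = graph_of V (\<lambda>e. u (idx V ` e) < edge_prob \<phi> e)"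

lemma product_prob_space_uniform: "product_prob_space (\<lambda>_. uniform_measure lborel {0..1::real})"
  by (intro product_prob_spaceI prob_space_uniform_measure) auto

lemma prob_space_marks: "prob_space marks"
  unfolding marks_def by (intro prob_space_PiM prob_space_uniform_measure) auto

lemma measurable_mark [measurable]: "(\<lambda>u. u i) \<in> borel_measurable marks"
proof -
  have "(\<lambda>u. u i) \<in> marks \<rightarrow>\<^sub>M uniform_measure lborel {0..1}"
    unfolding marks_def by measurable
  then show ?thesis
    by (simp cong: measurable_cong_sets)
qed

lemma measurable_marked_graph:
  "(\<lambda>(V, u). marked_graph V u) \<in> config_space \<Otimes>\<^sub>M marks \<rightarrow>\<^sub>M graph_space"
proof (rule measurable_graphI)
  show "(case \<omega> of (V, u) \<Rightarrow> marked_graph V u) \<in> graphs" if "\<omega> \<in> space (config_space \<Otimes>\<^sub>M marks)" for \<omega>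
    using that by (auto simp: space_pair_measure marked_graph_def intro!: graph_of_graphs)
  have v: "verts (case \<omega> of (V, u) \<Rightarrow> marked_graph V u) = fst \<omega>" for \<omega>
    by (simp add: marked_graph_def split_beta')
  show "(\<lambda>\<omega>. verts (case \<omega> of (V, u) \<Rightarrow> marked_graph V u)) \<in> config_space \<Otimes>\<^sub>M marks \<rightarrow>\<^sub>M config_space"
    unfolding v by measurable
  fix n m
  have *: "(is_pt n (fst \<omega>) \<and> is_pt m (fst \<omega>) \<and>
      (pt n (fst \<omega>), pt m (fst \<omega>)) \<in> adj (case \<omega> of (V, u) \<Rightarrow> marked_graph V u)) \<longleftrightarrow>
    is_pt n (fst \<omega>) \<and> is_pt m (fst \<omega>) \<and> pt n (fst \<omega>) \<noteq> pt m (fst \<omega>) \<and>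
      snd \<omega> {n, m} < \<phi> (pt n (fst \<omega>)) (pt m (fst \<omega>))" for \<omega>
    by (auto simp: marked_graph_def split_beta' adj_graph_of idx_pt pt_in)
  have "(\<lambda>\<omega>. snd \<omega> {n, m}) \<in> borel_measurable (config_space \<Otimes>\<^sub>M marks)"
    by measurable
  then show "Measurable.pred (config_space \<Otimes>\<^sub>M marks)
     (\<lambda>\<omega>. is_pt n (verts (case \<omega> of (V, u) \<Rightarrow> marked_graph V u)) \<and>
        is_pt m (verts (case \<omega> of (V, u) \<Rightarrow> marked_graph V u)) \<and>
        (pt n (verts (case \<omega> of (V, u) \<Rightarrow> marked_graph V u)),
          pt m (verts (case \<omega> of (V, u) \<Rightarrow> marked_graph V u)))
        \<in> adj (case \<omega> of (V, u) \<Rightarrow> marked_graph V u))"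
    unfolding v * by measurable
qed

lemma edge_law_eq_distr_marks:
  assumes V: "V \<in> configs"
  shows "edge_law \<phi> V = distr marks (\<Pi>\<^sub>M e\<in>pairs V. count_space UNIV)
    (\<lambda>u. \<lambda>e\<in>pairs V. u (idx V ` e) < edge_prob \<phi> e)"
    (is "_ = distr marks ?C ?t")
proof -
  let ?B = "\<lambda>e. measure_pmf (bernoulli_pmf (edge_prob \<phi> e))"
  interpret B: product_prob_space ?B "pairs V"
    by (intro product_prob_spaceI measure_pmf.prob_space_axioms)
  interpret U: product_prob_space "\<lambda>_ :: nat set. uniform_measure lborel {0..1::real}" UNIV
    by (rule product_prob_space_uniform)
  have t[measurable]: "?t \<in> marks \<rightarrow>\<^sub>M ?C"
    by measurable
  have inj: "inj_on (\<lambda>e. idx V ` e) (pairs V)"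
    by (rule inj_on_subset[OF inj_on_image_Pow[OF inj_on_idx[OF V]]]) (auto simp: pairs_def)
  have "distr marks ?C ?t = (\<Pi>\<^sub>M e\<in>pairs V. ?B e)"
  proof (rule B.PiM_eq)
    show "sets (distr marks ?C ?t) = sets (\<Pi>\<^sub>M e\<in>pairs V. ?B e)"
      unfolding sets_distr by (intro sets_PiM_cong) auto
    fix J F assume J: "finite J" "J \<subseteq> pairs V"
    define inv where "inv = the_inv_into (pairs V) (\<lambda>e. idx V ` e)"
    define X where "X i = {r. (r < edge_prob \<phi> (inv i)) \<in> F (inv i)}" for i
    have inv: "inv (idx V ` e) = e" if "e \<in> J" for e
      unfolding inv_def using J that by (intro the_inv_into_f_f[OF inj]) auto
    have X: "X i \<in> sets borel" for i
    proof -
      have "{r :: real. (r < p) \<in> G} \<in> sets borel" for p G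
        by measurable
      then show ?thesis by (simp add: X_def)
    qed
    have emb: "prod_emb (pairs V) ?B J (\<Pi>\<^sub>E j\<in>J. F j) \<in> sets ?C"
      using J by (subst sets_PiM_cong[OF refl, of _ _ ?B]) (auto intro!: sets_PiM_I)
    have "emeasure (distr marks ?C ?t) (prod_emb (pairs V) ?B J (\<Pi>\<^sub>E j\<in>J. F j)) =
        emeasure marks (?t -` prod_emb (pairs V) ?B J (\<Pi>\<^sub>E j\<in>J. F j) \<inter> space marks)"
      using emb by (rule emeasure_distr[OF t])
    also have "?t -` prod_emb (pairs V) ?B J (\<Pi>\<^sub>E j\<in>J. F j) \<inter> space marks =
        {u \<in> space marks. \<forall>i\<in>(\<lambda>e. idx V ` e) ` J. u i \<in> X i}"
      using J by (auto simp: prod_emb_def X_def inv PiE_iff restrict_def extensional_def subset_iff)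
    also have "emeasure marks \<dots> = (\<Prod>i\<in>(\<lambda>e. idx V ` e) ` J. emeasure (uniform_measure lborel {0..1}) (X i))"
      unfolding marks_def using J X by (intro U.emeasure_PiM_Collect) auto
    also have "\<dots> = (\<Prod>e\<in>J. emeasure (uniform_measure lborel {0..1}) (X (idx V ` e)))"
      using inj_on_subset[OF inj J(2)] by (simp add: prod.reindex)
    also have "\<dots> = (\<Prod>e\<in>J. emeasure (?B e) (F e))"
    proof (intro prod.cong refl)
      fix e assume e: "e \<in> J"
      with J have "e \<in> pairs V" by blast
      then show "emeasure (uniform_measure lborel {0..1}) (X (idx V ` e)) = emeasure (?B e) (F e)"
        unfolding X_def inv[OF e] by (intro emeasure_uniform_less edge_prob_bounds[of e V])
    qed
    finally show "emeasure (distr marks ?C ?t) (prod_emb (pairs V) ?B J (\<Pi>\<^sub>E j\<in>J. F j)) =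
        (\<Prod>e\<in>J. emeasure (?B e) (F e))" .
  qed
  then show ?thesis
    by (simp add: edge_law_def)
qed

lemma rcm_kernel_eq_distr_marks:
  assumes V: "V \<in> configs"
  shows "rcm_kernel \<phi> V = distr marks graph_space (marked_graph V)"
proof -
  let ?C = "\<Pi>\<^sub>M e\<in>pairs V. count_space (UNIV :: bool set)"
  have "graph_of V \<in> ?C \<rightarrow>\<^sub>M graph_space"
    using measurable_graph_of[OF V, of \<phi>] by (simp cong: measurable_cong_sets[OF sets_edge_law refl])
  then have "rcm_kernel \<phi> V = distr marks graph_space
      (\<lambda>u. graph_of V (\<lambda>e\<in>pairs V. u (idx V ` e) < edge_prob \<phi> e))"
    unfolding rcm_kernel_eq edge_law_eq_distr_marks[OF V] by (subst distr_distr) (auto simp: comp_def)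
  also have "(\<lambda>u. graph_of V (\<lambda>e\<in>pairs V. u (idx V ` e) < edge_prob \<phi> e)) = marked_graph V"
    unfolding marked_graph_def by (intro ext graph_of_cong) simp
  finally show ?thesis .
qed

lemma measurable_rcm_kernel [measurable]:
  "rcm_kernel \<phi> \<in> config_space \<rightarrow>\<^sub>M subprob_algebra graph_space"
proof -
  have "(\<lambda>V. distr marks graph_space (marked_graph V)) \<in> config_space \<rightarrow>\<^sub>M subprob_algebra graph_space"
  proof (rule measurable_distr2[OF measurable_marked_graph])
    show "(\<lambda>V. marks) \<in> config_space \<rightarrow>\<^sub>M subprob_algebra marks"
      by (intro measurable_const) (simp add: space_subprob_algebra prob_space_marks prob_space_imp_subprob_space)
  qed
  then show ?thesis
    by (rule measurable_cong[THEN iffD1, rotated]) (simp add: rcm_kernel_eq_distr_marks)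
qed

end

section \<open>Deleting and adding a vertex\<close>

lemma delete_vertex_graph_of:
  "z \<notin> W \<Longrightarrow> delete_vertex (graph_of (insert z W) s) z = graph_of W s"
  by (auto simp: delete_vertex_def induced_def graph_of_def)

text \<open>Forgetting the pairs that contain a deleted vertex is a marginal of the product.\<close>

lemma edge_law_restrict:
  assumes "W \<subseteq> V"
  shows "distr (edge_law \<phi> V) (edge_law \<phi> W) (\<lambda>s. restrict s (pairs W)) = edge_law \<phi> W"
  unfolding edge_law_def
  using pairs_mono[OF assms]
  by (intro distr_PiM_reindex[where f = "\<lambda>e. e"] measure_pmf.prob_space_axioms) auto

lemma measurable_restrict_edge_law:
  assumes "W \<subseteq> V"
  shows "(\<lambda>s. restrict s (pairs W)) \<in> edge_law \<phi> V \<rightarrow>\<^sub>M edge_law \<phi> W"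
  unfolding edge_law_def using pairs_mono[OF assms] by (rule measurable_restrict_subset)

text \<open>The coordinates of a product measure are independent, and hence so are its restrictions to
  disjoint sets of coordinates.\<close>

lemma indep_var_edge_law:
  assumes "A \<inter> B = {}" "A \<subseteq> pairs V" "B \<subseteq> pairs V" "pairs V \<noteq> {}"
  shows "prob_space.indep_var (edge_law \<phi> V)
    (\<Pi>\<^sub>M e\<in>A. count_space UNIV) (\<lambda>s. restrict s A) (\<Pi>\<^sub>M e\<in>B. count_space UNIV) (\<lambda>s. restrict s B)"
proof -
  let ?M = "\<lambda>e. measure_pmf (bernoulli_pmf (edge_prob \<phi> e))"
  interpret P: prob_space "edge_law \<phi> V"
    by (rule prob_space_edge_law)
  have comp: "(\<lambda>s. s e) \<in> edge_law \<phi> V \<rightarrow>\<^sub>M count_space UNIV" if "e \<in> pairs V" for e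
    using that by (simp cong: measurable_cong_sets[OF sets_edge_law refl])
  have "distr (edge_law \<phi> V) (\<Pi>\<^sub>M e\<in>pairs V. count_space UNIV) (\<lambda>s. \<lambda>e\<in>pairs V. s e) = edge_law \<phi> V"
  proof -
    have "distr (edge_law \<phi> V) (\<Pi>\<^sub>M e\<in>pairs V. count_space UNIV) (\<lambda>s. \<lambda>e\<in>pairs V. s e) =
        distr (edge_law \<phi> V) (edge_law \<phi> V) (\<lambda>s. \<lambda>e\<in>pairs V. s e)"
      by (intro distr_cong) (simp_all add: sets_edge_law)
    then show ?thesis
      by (simp add: edge_law_restrict)
  qed
  also have "\<dots> = (\<Pi>\<^sub>M e\<in>pairs V. distr (edge_law \<phi> V) (count_space UNIV) (\<lambda>s. s e))"
  proof -
    have "distr (edge_law \<phi> V) (count_space UNIV) (\<lambda>s. s e) = ?M e" if "e \<in> pairs V" for e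
    proof -
      have "distr (edge_law \<phi> V) (count_space UNIV) (\<lambda>s. s e) = distr (edge_law \<phi> V) (?M e) (\<lambda>s. s e)"
        by (intro distr_cong) simp_all
      also have "\<dots> = ?M e"
        unfolding edge_law_def using that
        by (intro distr_PiM_component measure_pmf.prob_space_axioms)
      finally show ?thesis .
    qed
    then show ?thesis
      unfolding edge_law_def by (intro PiM_cong) (simp_all add: edge_law_def)
  qed
  finally have "P.indep_vars (\<lambda>_. count_space UNIV) (\<lambda>e s. s e) (pairs V)"
    using assms(4) comp by (subst P.indep_vars_iff_distr_eq_PiM') auto
  from P.indep_var_restrict[OF this assms(1,2,3)] show ?thesis
    by simp
qed

context connection
begin

lemma AE_rcm_kernel_no_edge:
  assumes V: "V \<in> configs" and "u \<noteq> v" "\<phi> u v = 0"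
  shows "AE \<mu> in rcm_kernel \<phi> V. (u, v) \<notin> adj \<mu>"
proof -
  have "AE s in edge_law \<phi> V. (u, v) \<notin> adj (graph_of V s)"
  proof (cases "u \<in> V \<and> v \<in> V")
    case True
    then have e: "{u, v} \<in> pairs V"
      using assms(2) by (simp add: pairsI)
    have "AE b in measure_pmf (bernoulli_pmf (edge_prob \<phi> {u, v})). \<not> b"
      using assms(3) by (auto simp: AE_measure_pmf_iff set_pmf_iff)
    then have "AE s in edge_law \<phi> V. \<not> s {u, v}"
      unfolding edge_law_def using e
      by (intro AE_PiM_component[where P = Not] measure_pmf.prob_space_axioms)
    then show ?thesis
      by eventually_elim (simp add: adj_graph_of)
  qed (auto simp: adj_graph_of)
  moreover have "Measurable.pred graph_space (\<lambda>\<mu>. (u, v) \<notin> adj \<mu>)"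
    by measurable
  ultimately show ?thesis
    by (simp add: AE_rcm_kernel_iff[OF V])
qed

lemma AE_rcm_kernel_delete:
  assumes W: "W \<in> configs" and z: "z \<notin> W"
    and Q[measurable]: "Measurable.pred graph_space Q" and ae: "AE \<mu> in rcm_kernel \<phi> W. Q \<mu>"
  shows "AE \<mu> in rcm_kernel \<phi> (insert z W). Q (delete_vertex \<mu> z)"
proof -
  have V: "insert z W \<in> configs"
    using W by (rule configs_insert)
  have "AE t in distr (edge_law \<phi> (insert z W)) (edge_law \<phi> W) (\<lambda>s. restrict s (pairs W)). Q (graph_of W t)"
    using ae unfolding AE_rcm_kernel_iff[OF W Q] edge_law_restrict[OF subset_insertI] .
  then have "AE s in edge_law \<phi> (insert z W). Q (graph_of W (restrict s (pairs W)))"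
    by (rule AE_distrD[rotated]) (intro measurable_restrict_edge_law subset_insertI)
  moreover have "graph_of W (restrict s (pairs W)) = delete_vertex (graph_of (insert z W) s) z" for s
    unfolding delete_vertex_graph_of[OF z] by (rule graph_of_cong) simp
  ultimately have "AE s in edge_law \<phi> (insert z W). Q (delete_vertex (graph_of (insert z W) s) z)"
    by simp
  moreover have "Measurable.pred graph_space (\<lambda>\<mu>. Q (delete_vertex \<mu> z))"
    by measurable
  ultimately show ?thesis
    by (simp add: AE_rcm_kernel_iff[OF V])
qed

text \<open>The edges at a new vertex are independent of the graph to which it is added; so an event
  of that graph which is incompatible with a possible choice of finitely many new edges
  is null.\<close>

lemma AE_rcm_kernel_insert:
  assumes W: "W \<in> configs" and z: "z \<notin> W"
    and F: "finite F" "F \<noteq> {}" "F \<subseteq> W" and pos: "\<And>w. w \<in> F \<Longrightarrow> 0 < \<phi> z w"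
    and Q[measurable]: "Measurable.pred graph_space Q"
    and ae: "AE \<mu> in rcm_kernel \<phi> (insert z W). \<not> ((\<forall>w\<in>F. (z, w) \<in> adj \<mu>) \<and> Q (delete_vertex \<mu> z))"
  shows "AE \<mu> in rcm_kernel \<phi> W. \<not> Q \<mu>"
proof -
  let ?V = "insert z W" and ?M = "\<lambda>e. measure_pmf (bernoulli_pmf (edge_prob \<phi> e))"
  let ?P = "edge_law \<phi> ?V"
  define J where "J = (\<lambda>w. {z, w}) ` F"
  have V: "?V \<in> configs"
    using W by (rule configs_insert)
  have J: "finite J" "J \<noteq> {}" "J \<subseteq> pairs ?V" "J \<inter> pairs W = {}"
    using F z by (auto simp: J_def pairs_def doubleton_eq_iff)
  interpret P: prob_space ?P
    by (rule prob_space_edge_law)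
  interpret B: product_prob_space ?M "pairs ?V"
    by (intro product_prob_spaceI measure_pmf.prob_space_axioms)
  define E1 where "E1 = {t \<in> space (\<Pi>\<^sub>M e\<in>J. count_space (UNIV :: bool set)). \<forall>e\<in>J. t e}"
  define E2 where "E2 = {t \<in> space (edge_law \<phi> W). Q (graph_of W t)}"
  have [measurable]: "graph_of W \<in> edge_law \<phi> W \<rightarrow>\<^sub>M graph_space"
    by (rule measurable_graph_of[OF W])
  have E1: "E1 \<in> sets (\<Pi>\<^sub>M e\<in>J. count_space UNIV)"
    unfolding E1_def using J(1) by measurable
  have E2': "E2 \<in> sets (edge_law \<phi> W)"
    unfolding E2_def by measurable
  then have E2: "E2 \<in> sets (\<Pi>\<^sub>M e\<in>pairs W. count_space UNIV)"
    by (simp add: sets_edge_law)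
  define A1 where "A1 = (\<lambda>s. restrict s J) -` E1 \<inter> space ?P"
  define A2 where "A2 = (\<lambda>s. restrict s (pairs W)) -` E2 \<inter> space ?P"
  have "Measurable.pred graph_space (\<lambda>\<mu>. \<not> ((\<forall>w\<in>F. (z, w) \<in> adj \<mu>) \<and> Q (delete_vertex \<mu> z)))"
    using F(1) by measurable
  from ae[unfolded AE_rcm_kernel_iff[OF V this]]
  have ae': "AE s in ?P. \<not> ((\<forall>w\<in>F. s {z, w}) \<and> Q (graph_of W s))"
    using F(3) z by (auto simp: adj_graph_of delete_vertex_graph_of[OF z] subset_iff)
  have gr: "graph_of W (restrict s (pairs W)) = graph_of W s" for s
    by (rule graph_of_cong) simp
  \<comment> \<open>\<open>A1\<close> depends on the new edges and \<open>A2\<close> on the old ones.\<close>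
  have A: "A1 = {s \<in> space ?P. \<forall>e\<in>J. s e \<in> {True}}" "A2 = {s \<in> space ?P. Q (graph_of W s)}"
    by (auto simp: A1_def A2_def E1_def E2_def gr space_PiM space_edge_law)
  have "AE s in ?P. s \<notin> A1 \<inter> A2"
    using ae' by eventually_elim (auto simp: A J_def)
  then have "P.prob (A1 \<inter> A2) = 0"
    using P.prob_eq_0 by (metis measure_notin_sets)
  moreover have "P.prob (A1 \<inter> A2) = P.prob A1 * P.prob A2"
  proof -
    have "P.prob ((\<lambda>s. (restrict s J, restrict s (pairs W))) -` (E1 \<times> E2) \<inter> space ?P) = P.prob A1 * P.prob A2"
      unfolding A1_def A2_def using J
      by (intro P.indep_varD[OF indep_var_edge_law[of J "pairs W"] E1 E2] pairs_mono) auto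
    also have "(\<lambda>s. (restrict s J, restrict s (pairs W))) -` (E1 \<times> E2) \<inter> space ?P = A1 \<inter> A2"
      by (auto simp: A1_def A2_def)
    finally show ?thesis .
  qed
  moreover have "P.prob A1 \<noteq> 0"
  proof -
    have "emeasure ?P A1 = (\<Prod>e\<in>J. emeasure (?M e) {True})"
      unfolding A edge_law_def using J by (intro B.emeasure_PiM_Collect) auto
    moreover have "emeasure (?M e) {True} \<noteq> 0" if "e \<in> J" for e
    proof -
      obtain w where w: "w \<in> F" "e = {z, w}"
        using \<open>e \<in> J\<close> by (auto simp: J_def)
      then have "pmf (bernoulli_pmf (edge_prob \<phi> e)) True = \<phi> z w"
        using connection_nonneg connection_le_1 by simp
      then show ?thesis
        using pos[OF w(1)] by (simp add: emeasure_pmf_single)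
    qed
    ultimately have "emeasure ?P A1 \<noteq> 0"
      using J(1) by simp
    then show ?thesis
      by (simp add: P.emeasure_eq_measure)
  qed
  ultimately have "P.prob A2 = 0"
    by simp
  then have "AE s in ?P. \<not> Q (graph_of W (restrict s (pairs W)))"
  proof -
    have "A2 \<in> sets ?P"
      unfolding A2_def by (rule measurable_sets[OF measurable_restrict_edge_law[OF subset_insertI] E2'])
    with \<open>P.prob A2 = 0\<close> have "AE s in ?P. s \<notin> A2"
      by (simp add: P.prob_eq_0)
    then show ?thesis
      using AE_space by eventually_elim (simp add: A gr)
  qed
  then have "AE t in edge_law \<phi> W. \<not> Q (graph_of W t)"
    by (subst edge_law_restrict[of W ?V, symmetric, OF subset_insertI], subst AE_distr_iff)
      (auto intro: measurable_restrict_edge_law)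
  then show ?thesis
    by (subst AE_rcm_kernel_iff[OF W]) measurable
qed

end

section \<open>The Mecke equation\<close>

text \<open>The sum over the points of a configuration, as a sum over indices; only the latter is visibly
  measurable in the configuration.\<close>

lemma nn_integral_config_sum:
  fixes V :: "'a::polish_space set"
  assumes V: "V \<in> configs"
  shows "(\<integral>\<^sup>+n. (if is_pt n V then f (pt n V) else 0) \<partial>count_space UNIV) = (\<integral>\<^sup>+x. f x \<partial>count_space V)"
proof -
  have bij: "bij_betw (idx V) V {n. is_pt n V}"
  proof (rule bij_betwI[where g = "\<lambda>n. pt n V"])
    show "idx V \<in> V \<rightarrow> {n. is_pt n V}" "(\<lambda>n. pt n V) \<in> {n. is_pt n V} \<rightarrow> V"
      using is_pt_idx[OF V] pt_in by auto
  qed (auto simp: pt_idx[OF V] idx_pt)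
  have "(\<integral>\<^sup>+n. (if is_pt n V then f (pt n V) else 0) \<partial>count_space UNIV) =
      (\<integral>\<^sup>+n. f (pt n V) \<partial>count_space {n. is_pt n V})"
    by (subst nn_integral_count_space_indicator) (auto intro!: nn_integral_cong simp: indicator_def)
  also have "\<dots> = (\<integral>\<^sup>+x. f (pt (idx V x) V) \<partial>count_space V)"
    by (rule nn_integral_bij_count_space[OF bij, symmetric])
  also have "\<dots> = (\<integral>\<^sup>+x. f x \<partial>count_space V)"
    by (intro nn_integral_cong) (simp add: pt_idx[OF V])
  finally show ?thesis .
qed

text \<open>The law of a Poisson process enters through one identity: the number of points in a set \<open>A\<close> of
  finite intensity has mean \<open>L A\<close> and is uncorrelated with the event that a disjoint set \<open>B\<close> is
  empty. Taking void events instead of finitely many counts is enough to determine the Campbell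
  measure.\<close>

locale poisson_law = prob_space Pe for Pe :: "'a::polish_space set measure" +
  fixes L :: "'a measure"
  assumes sets_Pe [measurable_cong]: "sets Pe = sets config_space"
    and sets_L [measurable_cong]: "sets L = sets borel"
    and loc_fin: "locally_finite_measure L"
    and count_void: "A \<in> sets borel \<Longrightarrow> B \<in> sets borel \<Longrightarrow> A \<inter> B = {} \<Longrightarrow> emeasure L A < \<infinity> \<Longrightarrow>
      (\<integral>\<^sup>+V. emeasure (count_space UNIV) (V \<inter> A) * indicator {V. V \<inter> B = {}} V \<partial>Pe) =
      emeasure L A * emeasure Pe {V \<in> space Pe. V \<inter> B = {}}"
begin

lemma space_Pe: "space Pe = configs"
  using sets_eq_imp_space_eq[OF sets_Pe] by simp

lemma space_L [simp]: "space L = UNIV"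
  using sets_eq_imp_space_eq[OF sets_L] by simp

lemma emeasure_ball: "emeasure L (ball x r) < \<infinity>"
  using loc_fin by (auto simp: locally_finite_measure_def)

lemma UN_balls: "(\<Union>n::nat. ball x (real n)) = UNIV"
proof -
  have "\<exists>n::nat. dist x y < real n" for y
    by (rule reals_Archimedean2)
  then show ?thesis by auto
qed

sublocale L: sigma_finite_measure L
proof
  \<comment> \<open>The centre of the balls is arbitrary.\<close>
  let ?A = "range (\<lambda>n::nat. ball (undefined :: 'a) (real n))"
  have "emeasure L a \<noteq> \<infinity>" if "a \<in> ?A" for a
    using that emeasure_ball by (auto simp: less_top[symmetric])
  then show "\<exists>A. countable A \<and> A \<subseteq> sets L \<and> \<Union> A = space L \<and> (\<forall>a\<in>A. emeasure L a \<noteq> \<infinity>)"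
    by (intro exI[of _ ?A]) (auto simp: sets_L UN_balls)
qed

lemma sets_borel_finite_measure:
  "sets (borel :: 'a measure) = sigma_sets UNIV {A \<in> sets borel. emeasure L A < \<infinity>}"
    (is "_ = sigma_sets _ ?E")
proof
  show "sigma_sets UNIV ?E \<subseteq> sets borel"
    using sets.sigma_sets_subset[of ?E "borel :: 'a measure"] by auto
  show "sets (borel :: 'a measure) \<subseteq> sigma_sets UNIV ?E"
  proof
    fix A :: "'a set" assume A: "A \<in> sets borel"
    have "A \<inter> ball undefined (real n) \<in> ?E" for n
    proof -
      have "emeasure L (A \<inter> ball undefined (real n)) \<le> emeasure L (ball undefined (real n))"
        by (rule emeasure_mono) (auto simp: sets_L)
      then show ?thesis
        using A emeasure_ball[of undefined "real n"] by auto
    qed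
    then have "(\<Union>n. A \<inter> ball undefined (real n)) \<in> sigma_sets UNIV ?E"
      by (intro sigma_sets.Union sigma_sets.Basic)
    also have "(\<Union>n. A \<inter> ball undefined (real n)) = A"
      unfolding Int_UN_distrib[symmetric] UN_balls by simp
    finally show "A \<in> sigma_sets UNIV ?E" .
  qed
qed

text \<open>The two sides of the Mecke equation. The Campbell measure integrates over the process and
  sums over its points \<open>x\<close>, recording \<open>x\<close> and the configuration; the other measure integrates
  \<open>x\<close> with respect to the intensity, and adds it to the process.\<close>

definition campbell :: "('a \<times> 'a set) measure" where
  "campbell = distr (density (count_space UNIV \<Otimes>\<^sub>M Pe) (\<lambda>(n, V). (if is_pt n V then 1 else 0)))
     (borel \<Otimes>\<^sub>M config_space) (\<lambda>(n, V). (pt n V, V))"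

definition added_point :: "('a \<times> 'a set) measure" where
  "added_point = distr (L \<Otimes>\<^sub>M Pe) (borel \<Otimes>\<^sub>M config_space) (\<lambda>(x, V). (x, insert x V))"

lemma measurable_insert_pair:
  "(\<lambda>(x, V). (x, insert x V)) \<in> L \<Otimes>\<^sub>M Pe \<rightarrow>\<^sub>M borel \<Otimes>\<^sub>M config_space"
  by measurable

sublocale nat_Pe: pair_sigma_finite "count_space (UNIV :: nat set)" Pe
  by (intro pair_sigma_finite.intro sigma_finite_measure_count_space sigma_finite_measure_axioms)

sublocale L_Pe: pair_sigma_finite L Pe
  by (intro pair_sigma_finite.intro L.sigma_finite_measure_axioms sigma_finite_measure_axioms)

text \<open>On the event that \<open>B\<close> is empty, the points in \<open>A\<close> are those in \<open>A - B\<close>, and their number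
  is uncorrelated with the event.\<close>

lemma emeasure_campbell_void:
  assumes A[measurable]: "A \<in> sets borel" and fin: "emeasure L A < \<infinity>" and B[measurable]: "B \<in> sets borel"
  shows "emeasure campbell (A \<times> {V \<in> configs. V \<inter> B = {}}) =
    emeasure L (A - B) * emeasure Pe {V \<in> space Pe. V \<inter> B = {}}"
proof -
  let ?S = "A \<times> {V \<in> configs. V \<inter> B = {}}"
  have "{V \<in> space config_space. V \<inter> B = {}} \<in> sets config_space"
    by measurable
  then have S[measurable]: "?S \<in> sets (borel \<Otimes>\<^sub>M config_space)"
    by (intro pair_measureI) auto
  have "emeasure campbell ?S =
      (\<integral>\<^sup>+z. (\<lambda>(n, V). (if is_pt n V then 1 else 0)) z * indicator ?S ((\<lambda>(n, V). (pt n V, V)) z)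
        \<partial>(count_space UNIV \<Otimes>\<^sub>M Pe))"
    unfolding campbell_def
    by (subst emeasure_distr, measurable, subst emeasure_density, measurable)
       (auto intro!: nn_integral_cong simp: indicator_def)
  also have "\<dots> = (\<integral>\<^sup>+V. \<integral>\<^sup>+n. (if is_pt n V then 1 else 0) * indicator ?S (pt n V, V) \<partial>count_space UNIV \<partial>Pe)"
    by (subst nat_Pe.nn_integral_snd[symmetric]) (auto simp: split_beta')
  also have "\<dots> = (\<integral>\<^sup>+V. emeasure (count_space UNIV) (V \<inter> (A - B)) * indicator {V. V \<inter> B = {}} V \<partial>Pe)"
  proof (intro nn_integral_cong)
    fix V assume "V \<in> space Pe"
    then have V: "V \<in> configs" by (simp add: space_Pe)
    have "(\<integral>\<^sup>+n. (if is_pt n V then 1 else 0) * indicator ?S (pt n V, V) \<partial>count_space UNIV) =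
        (\<integral>\<^sup>+n. (if is_pt n V then indicator ?S (pt n V, V) else 0) \<partial>count_space UNIV)"
      by (intro nn_integral_cong) (simp add: indicator_def)
    also have "\<dots> = (\<integral>\<^sup>+x. indicator ?S (x, V) \<partial>count_space V)"
      by (rule nn_integral_config_sum[OF V])
    also have "\<dots> = (\<integral>\<^sup>+x. indicator (V \<inter> (A - B)) x * indicator {V. V \<inter> B = {}} V \<partial>count_space UNIV)"
      using V by (subst nn_integral_count_space_indicator) (auto intro!: nn_integral_cong simp: indicator_def)
    also have "\<dots> = emeasure (count_space UNIV) (V \<inter> (A - B)) * indicator {V. V \<inter> B = {}} V"
      by (subst nn_integral_multc) auto
    finally show "(\<integral>\<^sup>+n. (if is_pt n V then 1 else 0) * indicator ?S (pt n V, V) \<partial>count_space UNIV) =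
        emeasure (count_space UNIV) (V \<inter> (A - B)) * indicator {V. V \<inter> B = {}} V" .
  qed
  also have "\<dots> = emeasure L (A - B) * emeasure Pe {V \<in> space Pe. V \<inter> B = {}}"
  proof (rule count_void)
    have "emeasure L (A - B) \<le> emeasure L A"
      by (rule emeasure_mono) (auto simp: sets_L)
    then show "emeasure L (A - B) < \<infinity>"
      using fin by (rule le_less_trans)
  qed auto
  finally show ?thesis .
qed

text \<open>After adding \<open>x\<close>, the set \<open>B\<close> is empty iff it was empty before and does not contain \<open>x\<close>.\<close>

lemma emeasure_added_point_void:
  assumes A[measurable]: "A \<in> sets borel" and B[measurable]: "B \<in> sets borel"
  shows "emeasure added_point (A \<times> {V \<in> configs. V \<inter> B = {}}) =
    emeasure L (A - B) * emeasure Pe {V \<in> space Pe. V \<inter> B = {}}"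
proof -
  let ?S = "A \<times> {V \<in> configs. V \<inter> B = {}}"
  have "{V \<in> space config_space. V \<inter> B = {}} \<in> sets config_space"
    by measurable
  then have S[measurable]: "?S \<in> sets (borel \<Otimes>\<^sub>M config_space)"
    by (intro pair_measureI) auto
  have "emeasure added_point ?S =
      emeasure (L \<Otimes>\<^sub>M Pe) ((\<lambda>(x, V). (x, insert x V)) -` ?S \<inter> space (L \<Otimes>\<^sub>M Pe))"
    unfolding added_point_def by (rule emeasure_distr) measurable
  also have "(\<lambda>(x, V). (x, insert x V)) -` ?S \<inter> space (L \<Otimes>\<^sub>M Pe) = (A - B) \<times> {V \<in> space Pe. V \<inter> B = {}}"
    by (auto simp: space_pair_measure space_Pe configs_insert)
  also have "emeasure (L \<Otimes>\<^sub>M Pe) \<dots> = emeasure L (A - B) * emeasure Pe {V \<in> space Pe. V \<inter> B = {}}"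
    by (rule emeasure_pair_measure_Times) measurable
  finally show ?thesis .
qed

text \<open>The Mecke equation: both measures agree on the products of a set of finite intensity with a void
  event, and these products are a \<open>\<pi>\<close>-system that generates the product \<open>\<sigma>\<close>-algebra.\<close>

lemma campbell_eq_added_point: "campbell = added_point"
proof -
  let ?Ea = "{A \<in> sets borel. emeasure L A < \<infinity>}"
  let ?Eb = "{{V \<in> configs. V \<inter> B = {}} |B. B \<in> sets (borel :: 'a measure)}"
  let ?E = "{a \<times> b |a b. a \<in> ?Ea \<and> b \<in> ?Eb}"
  have gen: "sets (borel \<Otimes>\<^sub>M config_space :: ('a \<times> 'a set) measure) = sigma_sets (UNIV \<times> configs) ?E"
  proof -
    have "sets (borel \<Otimes>\<^sub>M config_space :: ('a \<times> 'a set) measure) =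
        sets (sigma (space borel \<times> space config_space) ?E)"
    proof (rule sets_pair_eq)
      show "sets borel = sigma_sets (space borel) ?Ea"
        using sets_borel_finite_measure by simp
      show "range (\<lambda>n::nat. ball undefined (real n)) \<subseteq> ?Ea"
        using emeasure_ball by auto
      show "\<Union> (range (\<lambda>n::nat. ball undefined (real n))) = space (borel :: 'a measure)"
        using UN_balls by simp
      show "sets config_space = sigma_sets (space config_space) ?Eb"
        using sets_config_space_void by simp
      show "{configs} \<subseteq> ?Eb"
        by (auto intro!: exI[of _ "{}"])
    qed auto
    also have "\<dots> = sigma_sets (UNIV \<times> configs) ?E"
      by (subst sets_measure_of) auto
    finally show ?thesis .
  qed
  show ?thesis
  proof (rule measure_eqI_generator_eq_countable)
    show "Int_stable ?E"
    proof (rule Int_stableI)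
      fix X Y assume "X \<in> ?E" "Y \<in> ?E"
      then obtain a b B c d D where X: "X = a \<times> b" "a \<in> ?Ea" "b = {V \<in> configs. V \<inter> B = {}}" "B \<in> sets borel"
        and Y: "Y = c \<times> d" "c \<in> ?Ea" "d = {V \<in> configs. V \<inter> D = {}}" "D \<in> sets borel"
        by blast
      have "emeasure L (a \<inter> c) \<le> emeasure L a"
        using X by (intro emeasure_mono) (auto simp: sets_L)
      then have "a \<inter> c \<in> ?Ea"
        using X Y by auto
      moreover have "b \<inter> d = {V \<in> configs. V \<inter> (B \<union> D) = {}}"
        using X Y by auto
      then have "b \<inter> d \<in> ?Eb"
        using X(4) Y(4) by blast
      moreover have "X \<inter> Y = (a \<inter> c) \<times> (b \<inter> d)"
        using X Y by auto
      ultimately show "X \<inter> Y \<in> ?E"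
        by blast
    qed
    show "?E \<subseteq> Pow (UNIV \<times> configs)"
      by auto
    show "emeasure campbell X = emeasure added_point X" if "X \<in> ?E" for X
      using that by (auto simp: emeasure_campbell_void emeasure_added_point_void)
    show "sets campbell = sigma_sets (UNIV \<times> configs) ?E" "sets added_point = sigma_sets (UNIV \<times> configs) ?E"
      by (simp_all add: campbell_def added_point_def gen)
    let ?C = "range (\<lambda>n::nat. ball (undefined :: 'a) (real n) \<times> {V \<in> configs. V \<inter> {} = {}})"
    show "?C \<subseteq> ?E"
    proof (rule image_subsetI)
      fix n :: nat
      have "ball undefined (real n) \<in> ?Ea"
        using emeasure_ball by simp
      moreover have "{V \<in> configs. V \<inter> {} = {}} \<in> ?Eb"
        by (intro CollectI exI[of _ "{}"]) simp
      ultimately show "ball undefined (real n) \<times> {V \<in> configs. V \<inter> {} = {}} \<in> ?E"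
        by blast
    qed
    have "\<Union> ?C = (\<Union>n::nat. ball (undefined :: 'a) (real n)) \<times> configs"
      by auto
    then show "\<Union> ?C = UNIV \<times> configs"
      unfolding UN_balls .
    show "emeasure campbell a \<noteq> \<infinity>" if "a \<in> ?C" for a
    proof -
      obtain n where a: "a = ball undefined (real n) \<times> {V \<in> configs. V \<inter> {} = {}}"
        using \<open>a \<in> ?C\<close> by blast
      have "emeasure campbell a = emeasure L (ball undefined (real n)) * emeasure Pe (space Pe)"
        unfolding a by (subst emeasure_campbell_void) (use emeasure_ball in auto)
      then show ?thesis
        using emeasure_ball[of undefined "real n"] by (simp add: emeasure_space_1)
    qed
  qed simp
qed

text \<open>The Mecke equation for null events, which is the form used from now on.\<close>

lemma AE_ball_iff_AE_insert:
  assumes P[measurable]: "Measurable.pred (borel \<Otimes>\<^sub>M config_space) (\<lambda>(x, V). P x V)"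
  shows "(AE V in Pe. \<forall>x\<in>V. P x V) \<longleftrightarrow> (AE x in L. AE V in Pe. P x (insert x V))"
proof -
  have "(AE z in campbell. (\<lambda>(x, V). P x V) z) \<longleftrightarrow>
      (AE z in density (count_space UNIV \<Otimes>\<^sub>M Pe) (\<lambda>(n, V). (if is_pt n V then 1 else 0)).
        (\<lambda>(x, V). P x V) ((\<lambda>(n, V). (pt n V, V)) z))"
    unfolding campbell_def by (rule AE_distr_iff) (auto simp: pred_def)
  also have "\<dots> \<longleftrightarrow> (AE z in count_space UNIV \<Otimes>\<^sub>M Pe. is_pt (fst z) (snd z) \<longrightarrow> P (pt (fst z) (snd z)) (snd z))"
    by (subst AE_density) (auto simp: split_beta' indicator_def)
  also have "\<dots> \<longleftrightarrow> (AE n in count_space UNIV. AE V in Pe. is_pt n V \<longrightarrow> P (pt n V) V)"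
  proof (rule nat_Pe.AE_pair_iff[symmetric])
    have "Measurable.pred (count_space UNIV \<Otimes>\<^sub>M Pe) (\<lambda>z. is_pt (fst z) (snd z) \<longrightarrow> P (pt (fst z) (snd z)) (snd z))"
    proof (rule measurable_pair_measure_countable1)
      fix n
      have [measurable]: "Measurable.pred Pe (\<lambda>V. P (pt n V) V)"
        using measurable_compose[of "\<lambda>V. (pt n V, V)" Pe "borel \<Otimes>\<^sub>M config_space" "\<lambda>(x, V). P x V"] by simp
      show "Measurable.pred Pe (\<lambda>V. is_pt (fst (n, V)) (snd (n, V)) \<longrightarrow>
          P (pt (fst (n, V)) (snd (n, V))) (snd (n, V)))"
        unfolding fst_conv snd_conv by measurable
    qed simp
    then show "{z \<in> space (count_space UNIV \<Otimes>\<^sub>M Pe). is_pt (fst z) (snd z) \<longrightarrow> P (pt (fst z) (snd z)) (snd z)}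
        \<in> sets (count_space UNIV \<Otimes>\<^sub>M Pe)"
      by (simp add: pred_def)
  qed
  also have "\<dots> \<longleftrightarrow> (AE V in Pe. \<forall>n. is_pt n V \<longrightarrow> P (pt n V) V)"
    by (simp add: AE_count_space AE_all_countable)
  also have "\<dots> \<longleftrightarrow> (AE V in Pe. \<forall>x\<in>V. P x V)"
  proof (rule AE_cong)
    fix V assume "V \<in> space Pe"
    then have "V \<in> configs" by (simp add: space_Pe)
    from ex_pt_iff[OF this, of "\<lambda>x. \<not> P x V"]
    show "(\<forall>n. is_pt n V \<longrightarrow> P (pt n V) V) \<longleftrightarrow> (\<forall>x\<in>V. P x V)"
      by blast
  qed
  finally have 1: "(AE z in campbell. (\<lambda>(x, V). P x V) z) \<longleftrightarrow> (AE V in Pe. \<forall>x\<in>V. P x V)" .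
  have m[measurable]: "Measurable.pred (L \<Otimes>\<^sub>M Pe) (\<lambda>z. P (fst z) (insert (fst z) (snd z)))"
    using measurable_compose[OF measurable_insert_pair P] by (simp add: split_beta')
  have "(AE z in added_point. (\<lambda>(x, V). P x V) z) \<longleftrightarrow>
      (AE z in L \<Otimes>\<^sub>M Pe. (\<lambda>(x, V). P x V) ((\<lambda>(x, V). (x, insert x V)) z))"
    unfolding added_point_def by (rule AE_distr_iff) (auto simp: pred_def)
  also have "\<dots> \<longleftrightarrow> (AE z in L \<Otimes>\<^sub>M Pe. P (fst z) (insert (fst z) (snd z)))"
    by (simp add: split_beta')
  also have "\<dots> \<longleftrightarrow> (AE x in L. AE V in Pe. P x (insert x V))"
    by (rule L_Pe.AE_pair_iff[symmetric]) measurable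
  finally have 2: "(AE z in added_point. (\<lambda>(x, V). P x V) z) \<longleftrightarrow> (AE x in L. AE V in Pe. P x (insert x V))" .
  show ?thesis
    by (rule trans[OF 1[unfolded campbell_eq_added_point, symmetric] 2])
qed

end

section \<open>The Poisson process\<close>

lemma measurable_ecard_config:
  fixes A :: "'a::polish_space set"
  assumes [measurable]: "A \<in> sets borel"
  shows "(\<lambda>V. ecard (V \<inter> A)) \<in> config_space \<rightarrow>\<^sub>M count_space UNIV"
proof (rule measurableI)
  fix S :: "enat set"
  have "Measurable.pred config_space (\<lambda>V. \<exists>k\<in>S. ecard (V \<inter> A) = k)"
    by measurable
  then show "(\<lambda>V. ecard (V \<inter> A)) -` S \<inter> space config_space \<in> sets config_space"
    by (simp add: pred_def vimage_def Int_def conj_commute)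
qed simp

lemma emeasure_count_space_ecard: "emeasure (count_space UNIV) A = ennreal_of_enat (ecard A)"
  by (simp add: ecard_def emeasure_count_space ennreal_of_enat_def)

lemma (in prob_space) nn_integral_poisson:
  assumes X: "X \<in> M \<rightarrow>\<^sub>M count_space UNIV" and m: "0 \<le> m"
    and dist: "\<And>k. prob {\<omega> \<in> space M. X \<omega> = enat k} = m ^ k / fact k * exp (- m)"
  shows "(\<integral>\<^sup>+\<omega>. ennreal_of_enat (X \<omega>) \<partial>M) = ennreal m"
proof -
  let ?E = "\<lambda>k. {\<omega> \<in> space M. X \<omega> = enat k}" and ?p = "\<lambda>k. m ^ k / fact k * exp (- m)"
  have exp_sums: "(\<lambda>k. m ^ k / fact k) sums exp m"
    using exp_converges[of m] by (simp add: divide_inverse mult.commute)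
  have "(\<lambda>k. ?p k) sums (exp m * exp (- m))"
    by (rule sums_mult2[OF exp_sums])
  then have p_sums: "?p sums 1"
    by (simp add: exp_minus)
  \<comment> \<open>The mean: \<open>(k + 1) p\<^sub>k\<^sub>+\<^sub>1 = m p\<^sub>k\<close> for the Poisson weights.\<close>
  have "(\<lambda>k. m * ?p k) sums (m * 1)"
    by (rule sums_mult[OF p_sums])
  also have "(\<lambda>k. m * ?p k) = (\<lambda>k. real (Suc k) * ?p (Suc k))"
    by (simp add: fun_eq_iff del: of_nat_Suc)
  finally have mean_sums: "(\<lambda>k. real k * ?p k) sums m"
    by (subst (asm) sums_Suc_iff) simp
  have E: "?E k \<in> events" for k
    using measurable_sets[OF X, of "{enat k}"] by (simp add: vimage_def Int_def conj_commute)
  \<comment> \<open>The weights add up to one, so the value \<open>\<infinity>\<close> has probability zero.\<close>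
  have "(\<lambda>k. prob (?E k)) sums prob (\<Union>k. ?E k)"
    by (rule finite_measure_UNION) (use E in \<open>auto simp: disjoint_family_on_def\<close>)
  then have "prob (\<Union>k. ?E k) = 1"
    using p_sums sums_unique2 unfolding dist by blast
  moreover have "(\<Union>k. ?E k) \<in> events"
    using E by blast
  ultimately have fin: "AE \<omega> in M. \<omega> \<in> (\<Union>k. ?E k)"
    by (simp add: prob_eq_1)
  have "(\<integral>\<^sup>+\<omega>. ennreal_of_enat (X \<omega>) \<partial>M) = (\<integral>\<^sup>+\<omega>. (\<Sum>k. of_nat k * indicator (?E k) \<omega>) \<partial>M)"
  proof (rule nn_integral_cong_AE)
    show "AE \<omega> in M. ennreal_of_enat (X \<omega>) = (\<Sum>k. of_nat k * indicator (?E k) \<omega>)"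
      using fin
    proof eventually_elim
      case (elim \<omega>)
      then obtain j where j: "\<omega> \<in> space M" "X \<omega> = enat j"
        by auto
      then have "(\<Sum>k. of_nat k * indicator (?E k) \<omega> :: ennreal) = (\<Sum>k\<in>{j}. of_nat k * indicator (?E k) \<omega>)"
        by (intro suminf_finite) (auto simp: indicator_def)
      then show ?case
        using j by (simp add: ennreal_of_enat_def)
    qed
  qed
  also have "\<dots> = (\<Sum>k. of_nat k * emeasure M (?E k))"
    using E by (subst nn_integral_suminf) (simp_all add: nn_integral_cmult_indicator)
  also have "\<dots> = (\<Sum>k. ennreal (real k * ?p k))"
  proof (rule suminf_cong)
    show "of_nat k * emeasure M (?E k) = ennreal (real k * ?p k)" for k
      unfolding emeasure_eq_measure dist ennreal_of_nat_eq_real_of_nat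
      using m by (intro ennreal_mult[symmetric]) simp_all
  qed
  also have "\<dots> = ennreal m"
    using m mean_sums by (intro suminf_ennreal_eq) auto
  finally show ?thesis .
qed

text \<open>The counts in two disjoint sets are independent, so the expectation of the product factors.\<close>

lemma poisson_process_count_void:
  fixes \<eta> :: "'w \<Rightarrow> 'a::polish_space set"
  assumes pp: "poisson_process M L \<eta>"
    and A: "A \<in> sets borel" and B: "B \<in> sets borel" and disj: "A \<inter> B = {}" and fin: "emeasure L A < \<infinity>"
  shows "(\<integral>\<^sup>+V. emeasure (count_space UNIV) (V \<inter> A) * indicator {V. V \<inter> B = {}} V \<partial>distr M config_space \<eta>) =
    emeasure L A * emeasure (distr M config_space \<eta>) {V \<in> space (distr M config_space \<eta>). V \<inter> B = {}}"
proof -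
  interpret prob_space M
    using pp by (simp add: poisson_process_def)
  have \<eta>: "\<eta> \<in> M \<rightarrow>\<^sub>M config_space"
    using pp by (simp add: poisson_process_def)
  have N: "(\<lambda>\<omega>. ecard (\<eta> \<omega> \<inter> D)) \<in> M \<rightarrow>\<^sub>M count_space UNIV" if "D \<in> sets borel" for D
    by (rule measurable_compose[OF \<eta> measurable_ecard_config[OF that]])
  define D where "D i = (if i = 0 then A else B)" for i :: nat
  define f where "f i e = (if i = 0 then ennreal_of_enat e else if e = 0 then 1 else 0)" for i :: nat and e
  define X where "X i \<omega> = f i (ecard (\<eta> \<omega> \<inter> D i))" for i \<omega>
  have "indep_vars (\<lambda>_. count_space UNIV) (\<lambda>i \<omega>. ecard (\<eta> \<omega> \<inter> D i)) {..<2}"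
  proof -
    have "\<forall>i<2. D i \<in> sets borel" "disjoint_family_on D {..<2}"
      using A B disj by (auto simp: D_def disjoint_family_on_def)
    then show ?thesis
      using pp unfolding poisson_process_def by blast
  qed
  then have indep: "indep_vars (\<lambda>_. borel) X {..<2}"
    unfolding X_def by (rule indep_vars_compose2) simp
  have "(\<integral>\<^sup>+\<omega>. (\<Prod>i\<in>{..<2}. X i \<omega>) \<partial>M) = (\<Prod>i\<in>{..<2}. \<integral>\<^sup>+\<omega>. X i \<omega> \<partial>M)"
    by (rule indep_vars_nn_integral[OF _ indep]) simp_all
  then have prod: "(\<integral>\<^sup>+\<omega>. X 0 \<omega> * X 1 \<omega> \<partial>M) = (\<integral>\<^sup>+\<omega>. X 0 \<omega> \<partial>M) * (\<integral>\<^sup>+\<omega>. X 1 \<omega> \<partial>M)"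
    by (simp add: numeral_2_eq_2 lessThan_Suc mult.commute)
  have X0: "(\<integral>\<^sup>+\<omega>. X 0 \<omega> \<partial>M) = emeasure L A"
  proof -
    have "(\<integral>\<^sup>+\<omega>. ennreal_of_enat (ecard (\<eta> \<omega> \<inter> A)) \<partial>M) = ennreal (measure L A)"
      using pp A fin by (intro nn_integral_poisson N) (auto simp: poisson_process_def)
    also have "\<dots> = emeasure L A"
      using fin by (simp add: emeasure_eq_ennreal_measure less_top)
    finally show ?thesis
      by (simp add: X_def f_def D_def)
  qed
  have void: "{V \<in> space config_space. V \<inter> B = {}} \<in> sets config_space"
    using B by measurable
  have X1: "(\<integral>\<^sup>+\<omega>. X 1 \<omega> \<partial>M) =
      emeasure (distr M config_space \<eta>) {V \<in> space (distr M config_space \<eta>). V \<inter> B = {}}"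
  proof -
    have "emeasure (distr M config_space \<eta>) {V \<in> space config_space. V \<inter> B = {}} =
        (\<integral>\<^sup>+V. indicator {V \<in> space config_space. V \<inter> B = {}} V \<partial>distr M config_space \<eta>)"
      using void by (subst nn_integral_indicator) simp_all
    also have "\<dots> = (\<integral>\<^sup>+\<omega>. indicator {V \<in> space config_space. V \<inter> B = {}} (\<eta> \<omega>) \<partial>M)"
      using void by (intro nn_integral_distr[OF \<eta>]) simp
    also have "\<dots> = (\<integral>\<^sup>+\<omega>. X 1 \<omega> \<partial>M)"
      using measurable_space[OF \<eta>]
      by (intro nn_integral_cong) (auto simp: X_def f_def D_def indicator_def ecard_eq_0_iff)
    finally show ?thesis by simp
  qed
  have meas: "(\<lambda>V. ennreal_of_enat (ecard (V \<inter> A)) * f 1 (ecard (V \<inter> B))) \<in> borel_measurable (distr M config_space \<eta>)"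
    unfolding measurable_distr_eq1
  proof -
    have [measurable]: "(\<lambda>V. ennreal_of_enat (ecard (V \<inter> A))) \<in> borel_measurable config_space"
      by (rule measurable_compose[OF measurable_ecard_config[OF A]]) simp
    have [measurable]: "(\<lambda>V. f 1 (ecard (V \<inter> B))) \<in> borel_measurable config_space"
      by (rule measurable_compose[OF measurable_ecard_config[OF B]]) simp
    show "(\<lambda>V. ennreal_of_enat (ecard (V \<inter> A)) * f 1 (ecard (V \<inter> B))) \<in> borel_measurable config_space"
      by measurable
  qed
  have "(\<integral>\<^sup>+V. emeasure (count_space UNIV) (V \<inter> A) * indicator {V. V \<inter> B = {}} V \<partial>distr M config_space \<eta>) =
      (\<integral>\<^sup>+V. ennreal_of_enat (ecard (V \<inter> A)) * f 1 (ecard (V \<inter> B)) \<partial>distr M config_space \<eta>)"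
    by (intro nn_integral_cong) (simp add: emeasure_count_space_ecard f_def indicator_def ecard_eq_0_iff)
  also have "\<dots> = (\<integral>\<^sup>+\<omega>. X 0 \<omega> * X 1 \<omega> \<partial>M)"
    by (subst nn_integral_distr[OF \<eta> meas]) (simp add: X_def f_def D_def)
  finally show ?thesis
    using prod X0 X1 by simp
qed

section \<open>Almost sure properties of the random connection model\<close>

lemma pred_AE_iff_nn_integral:
  assumes "Measurable.pred M P"
  shows "(AE x in M. P x) \<longleftrightarrow> (\<integral>\<^sup>+x. (if P x then 0 else 1) \<partial>M) = 0"
proof -
  have "(\<lambda>x. if P x then 0 else 1 :: ennreal) \<in> borel_measurable M"
    using assms by measurable
  from nn_integral_0_iff_AE[OF this] show ?thesis
    by simp
qed

lemma pred_AE_kernel: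
  assumes K: "K \<in> N \<rightarrow>\<^sub>M subprob_algebra R"
    and P[measurable]: "Measurable.pred (N \<Otimes>\<^sub>M R) (\<lambda>(x, y). P x y)"
  shows "Measurable.pred N (\<lambda>x. AE y in K x. P x y)"
proof -
  have *: "(AE y in K x. P x y) \<longleftrightarrow> (\<integral>\<^sup>+y. (if P x y then 0 else 1) \<partial>K x) = 0" if x: "x \<in> space N" for x
  proof (rule pred_AE_iff_nn_integral)
    have "(\<lambda>y. (x, y)) \<in> R \<rightarrow>\<^sub>M N \<Otimes>\<^sub>M R"
      using x by measurable
    from measurable_compose[OF this P] have "Measurable.pred R (P x)"
      by simp
    then show "Measurable.pred (K x) (P x)"
      using measurable_cong_sets[OF subprob_measurableD(2)[OF K x] refl] by blast
  qed
  have "(\<lambda>(x, y). if P x y then 0 else 1 :: ennreal) \<in> borel_measurable (N \<Otimes>\<^sub>M R)"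
    unfolding split_beta' using P unfolding split_beta' by measurable
  then have "(\<lambda>x. \<integral>\<^sup>+y. (if P x y then 0 else 1) \<partial>K x) \<in> borel_measurable N"
    using K by (rule nn_integral_measurable_subprob_algebra2)
  then have "Measurable.pred N (\<lambda>x. (\<integral>\<^sup>+y. (if P x y then 0 else 1) \<partial>K x) = 0)"
    by measurable
  then show ?thesis
    by (subst measurable_cong[OF *])
qed

lemma (in sigma_finite_measure) pred_AE:
  assumes P: "Measurable.pred (N \<Otimes>\<^sub>M M) (\<lambda>(x, y). P x y)"
  shows "Measurable.pred N (\<lambda>x. AE y in M. P x y)"
proof -
  have *: "(AE y in M. P x y) \<longleftrightarrow> (\<integral>\<^sup>+y. (if P x y then 0 else 1) \<partial>M) = 0" if x: "x \<in> space N" for x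
  proof (rule pred_AE_iff_nn_integral)
    have "(\<lambda>y. (x, y)) \<in> M \<rightarrow>\<^sub>M N \<Otimes>\<^sub>M M"
      using x by measurable
    from measurable_compose[OF this P] show "Measurable.pred M (P x)"
      by simp
  qed
  have "(\<lambda>(x, y). if P x y then 0 else 1 :: ennreal) \<in> borel_measurable (N \<Otimes>\<^sub>M M)"
    unfolding split_beta' using P unfolding split_beta' by measurable
  then have "(\<lambda>x. \<integral>\<^sup>+y. (if P x y then 0 else 1) \<partial>M) \<in> borel_measurable N"
    by (intro borel_measurable_nn_integral)
  then have "Measurable.pred N (\<lambda>x. (\<integral>\<^sup>+y. (if P x y then 0 else 1) \<partial>M) = 0)"
    by measurable
  then show ?thesis
    by (subst measurable_cong[OF *])
qed

context connection
begin

text \<open>Unfolds the law of the random connection model on a modified Poisson process into a statement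
  about the law of \<open>\<eta>\<close> and the kernel; \<open>f\<close> will add points.\<close>

lemma AE_rcm_law_iff:
  assumes \<eta>: "\<eta> \<in> M \<rightarrow>\<^sub>M config_space" and f: "f \<in> config_space \<rightarrow>\<^sub>M config_space"
    and P: "Measurable.pred graph_space P"
  shows "(AE \<mu> in rcm_law \<phi> M (\<lambda>\<omega>. f (\<eta> \<omega>)). P \<mu>) \<longleftrightarrow>
    (AE V in distr M config_space \<eta>. AE \<mu> in rcm_kernel \<phi> (f V). P \<mu>)"
proof -
  have Q: "Measurable.pred config_space (\<lambda>V. AE \<mu> in rcm_kernel \<phi> V. P \<mu>)"
    by (rule pred_AE_kernel[OF measurable_rcm_kernel])
       (auto simp: split_beta' intro: measurable_compose[OF measurable_snd P])
  have "(AE \<mu> in rcm_law \<phi> M (\<lambda>\<omega>. f (\<eta> \<omega>)). P \<mu>) \<longleftrightarrow>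
      (AE V in distr M config_space (\<lambda>\<omega>. f (\<eta> \<omega>)). AE \<mu> in rcm_kernel \<phi> V. P \<mu>)"
    unfolding rcm_law_def by (rule AE_bind[OF _ P]) (simp add: measurable_rcm_kernel)
  also have "\<dots> \<longleftrightarrow> (AE \<omega> in M. AE \<mu> in rcm_kernel \<phi> (f (\<eta> \<omega>)). P \<mu>)"
    using Q measurable_compose[OF \<eta> f] by (intro AE_distr_iff) (simp_all add: pred_def)
  also have "\<dots> \<longleftrightarrow> (AE V in distr M config_space \<eta>. AE \<mu> in rcm_kernel \<phi> (f V). P \<mu>)"
    using measurable_compose[OF f Q] \<eta> by (intro AE_distr_iff[symmetric]) (simp_all add: pred_def)
  finally show ?thesis .
qed

end

locale rcm = poisson_law Pe L + connection \<phi>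
  for Pe :: "'a::polish_space set measure" and L :: "'a measure" and \<phi> :: "'a \<Rightarrow> 'a \<Rightarrow> real" +
  assumes diffuse: "emeasure L {x} = 0"
begin

lemma AE_neq: "AE y in L. y \<noteq> x"
proof (rule AE_I)
  show "{y \<in> space L. \<not> y \<noteq> x} \<subseteq> {x}" by auto
  show "emeasure L {x} = 0" by (rule diffuse)
  show "{x} \<in> sets L" by (simp add: sets_L)
qed

lemma pred_AE_Pe:
  assumes "Measurable.pred (N \<Otimes>\<^sub>M config_space) (\<lambda>(x, V). P x V)"
  shows "Measurable.pred N (\<lambda>x. AE V in Pe. P x V)"
proof (rule pred_AE_kernel[OF _ assms])
  show "(\<lambda>_. Pe) \<in> N \<rightarrow>\<^sub>M subprob_algebra config_space"
    using sets_Pe prob_space_axioms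
    by (intro measurable_const) (simp add: space_subprob_algebra prob_space_imp_subprob_space)
qed

lemma pred_AE_rcm_kernel:
  assumes f: "f \<in> N \<rightarrow>\<^sub>M config_space"
    and P: "Measurable.pred (N \<Otimes>\<^sub>M graph_space) (\<lambda>(x, \<mu>). P x \<mu>)"
  shows "Measurable.pred N (\<lambda>x. AE \<mu> in rcm_kernel \<phi> (f x). P x \<mu>)"
  by (rule pred_AE_kernel[OF measurable_compose[OF f measurable_rcm_kernel] P])

lemma pred_AE_L:
  assumes "Measurable.pred (N \<Otimes>\<^sub>M borel) (\<lambda>(x, y). P x y)"
  shows "Measurable.pred N (\<lambda>x. AE y in L. P x y)"
proof (rule L.pred_AE)
  show "Measurable.pred (N \<Otimes>\<^sub>M L) (\<lambda>(x, y). P x y)"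
    using assms measurable_cong_sets[OF sets_pair_measure_cong[OF refl sets_L, of N] refl] by blast
qed

text \<open>An almost sure property of the process, viewed as a property of its points that does not
  depend on the point, is passed on to the process with an added point by the Mecke equation.\<close>

lemma AE_insert:
  assumes A: "Measurable.pred config_space A" and ae: "AE V in Pe. A V"
  shows "AE x in L. AE V in Pe. A (insert x V)"
proof -
  have "Measurable.pred (borel \<Otimes>\<^sub>M config_space) (\<lambda>(x :: 'a, V). A V)"
    unfolding split_beta' using measurable_compose[OF measurable_snd A] .
  moreover have "AE V in Pe. \<forall>x\<in>V. A V"
    using ae by eventually_elim blast
  ultimately show ?thesis
    by (rule iffD1[OF AE_ball_iff_AE_insert])
qed

lemma AE_insert2:
  assumes A: "Measurable.pred config_space A" and ae: "AE V in Pe. A V"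
  shows "AE x in L. AE y in L. AE V in Pe. A (insert x (insert y V))"
  using AE_insert[OF A ae]
proof eventually_elim
  fix x assume "AE V in Pe. A (insert x V)"
  moreover have "Measurable.pred config_space (\<lambda>V. A (insert x V))"
    by (rule measurable_compose[OF _ A]) measurable
  ultimately show "AE y in L. AE V in Pe. A (insert x (insert y V))"
    by (intro AE_insert)
qed

lemma AE_insert3:
  assumes A: "Measurable.pred config_space A" and ae: "AE V in Pe. A V"
  shows "AE x in L. AE y in L. AE z in L. AE V in Pe. A (insert x (insert y (insert z V)))"
  using AE_insert[OF A ae]
proof eventually_elim
  fix x assume "AE V in Pe. A (insert x V)"
  moreover have "Measurable.pred config_space (\<lambda>V. A (insert x V))"
    by (rule measurable_compose[OF _ A]) measurable
  ultimately show "AE y in L. AE z in L. AE V in Pe. A (insert x (insert y (insert z V)))"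
    by (intro AE_insert2)
qed

lemma AE_not_mem: "AE V in Pe. x \<notin> V"
proof -
  have "Measurable.pred (borel \<Otimes>\<^sub>M config_space) (\<lambda>(y :: 'a, V :: 'a set). y \<noteq> x)"
    unfolding split_beta' by measurable
  moreover have "AE y in L. AE V in Pe. y \<noteq> x"
    using AE_neq[of x] by eventually_elim simp
  ultimately have "AE V in Pe. \<forall>y\<in>V. y \<noteq> x"
    by (rule iffD2[OF AE_ball_iff_AE_insert])
  then show ?thesis
    by eventually_elim blast
qed

text \<open>The Mecke equation applied twice, the second time with the first point \<open>x\<close> fixed and already
  added.\<close>

lemma AE_pairs:
  assumes P: "Measurable.pred ((borel \<Otimes>\<^sub>M borel) \<Otimes>\<^sub>M config_space) (\<lambda>((x, y), V). P x y V)"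
    and ae: "AE x in L. AE y in L. AE V in Pe. P x y (insert x (insert y V))"
  shows "AE V in Pe. \<forall>x\<in>V. \<forall>y\<in>V. x \<noteq> y \<longrightarrow> P x y V"
proof -
  have P': "Measurable.pred N (\<lambda>\<omega>. P (f \<omega>) (g \<omega>) (h \<omega>))"
    if [measurable]: "f \<in> borel_measurable N" "g \<in> borel_measurable N" "h \<in> N \<rightarrow>\<^sub>M config_space"
    for f g h and N :: "'b measure"
  proof -
    have "(\<lambda>\<omega>. ((f \<omega>, g \<omega>), h \<omega>)) \<in> N \<rightarrow>\<^sub>M (borel \<Otimes>\<^sub>M borel) \<Otimes>\<^sub>M config_space"
      by measurable
    from measurable_compose[OF this P] show ?thesis
      by simp
  qed
  have "Measurable.pred (borel \<Otimes>\<^sub>M config_space) (\<lambda>(x, V). \<forall>y\<in>V. x \<noteq> y \<longrightarrow> P x y V)"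
    unfolding split_beta'
  proof (rule measurable_config_ball)
    show "Measurable.pred ((borel \<Otimes>\<^sub>M config_space) \<Otimes>\<^sub>M borel)
        (\<lambda>(\<omega>, y). fst \<omega> \<noteq> y \<longrightarrow> P (fst \<omega>) y (snd \<omega>))"
      unfolding split_beta' by (intro pred_intros_logic(4) P') measurable
  qed measurable
  moreover from ae have "AE x in L. AE V in Pe. \<forall>y\<in>insert x V. x \<noteq> y \<longrightarrow> P x y (insert x V)"
  proof eventually_elim
    fix x assume ae: "AE y in L. AE V in Pe. P x y (insert x (insert y V))"
    have "Measurable.pred (borel \<Otimes>\<^sub>M config_space) (\<lambda>(y, V). P x y (insert x V))"
      unfolding split_beta' by (intro P') measurable
    from iffD2[OF AE_ball_iff_AE_insert[OF this] ae]
    show "AE V in Pe. \<forall>y\<in>insert x V. x \<noteq> y \<longrightarrow> P x y (insert x V)"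
      by eventually_elim auto
  qed
  ultimately show ?thesis
    by (rule iffD2[OF AE_ball_iff_AE_insert])
qed

lemma AE_rcm_pairs:
  assumes P: "Measurable.pred ((borel \<Otimes>\<^sub>M borel) \<Otimes>\<^sub>M graph_space) (\<lambda>((x, y), \<mu>). P x y \<mu>)"
    and ae: "AE x in L. AE y in L. AE V in Pe. AE \<mu> in rcm_kernel \<phi> (insert x (insert y V)). P x y \<mu>"
  shows "AE V in Pe. AE \<mu> in rcm_kernel \<phi> V. \<forall>x\<in>verts \<mu>. \<forall>y\<in>verts \<mu>. x \<noteq> y \<longrightarrow> P x y \<mu>"
proof -
  have P': "Measurable.pred N (\<lambda>\<omega>. P (f \<omega>) (g \<omega>) (h \<omega>))"
    if [measurable]: "f \<in> borel_measurable N" "g \<in> borel_measurable N" "h \<in> N \<rightarrow>\<^sub>M graph_space"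
    for f g h and N :: "'b measure"
  proof -
    have "(\<lambda>\<omega>. ((f \<omega>, g \<omega>), h \<omega>)) \<in> N \<rightarrow>\<^sub>M (borel \<Otimes>\<^sub>M borel) \<Otimes>\<^sub>M graph_space"
      by measurable
    from measurable_compose[OF this P] show ?thesis
      by simp
  qed
  have "Measurable.pred ((borel \<Otimes>\<^sub>M borel) \<Otimes>\<^sub>M config_space)
      (\<lambda>((x, y), V). AE \<mu> in rcm_kernel \<phi> V. P x y \<mu>)"
    unfolding split_beta'
  proof (rule pred_AE_rcm_kernel)
    show "Measurable.pred (((borel \<Otimes>\<^sub>M borel) \<Otimes>\<^sub>M config_space) \<Otimes>\<^sub>M graph_space)
        (\<lambda>(z, \<mu>). P (fst (fst z)) (snd (fst z)) \<mu>)"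
      unfolding split_beta' by (intro P') measurable
  qed measurable
  from AE_pairs[OF this ae] AE_space[of Pe] show ?thesis
  proof eventually_elim
    fix V assume V: "\<forall>x\<in>V. \<forall>y\<in>V. x \<noteq> y \<longrightarrow> (AE \<mu> in rcm_kernel \<phi> V. P x y \<mu>)" "V \<in> space Pe"
    have m1: "Measurable.pred graph_space (\<lambda>\<mu>. x \<noteq> y \<longrightarrow> P x y \<mu>)" for x y
      by (intro pred_intros_logic(4) P') measurable
    have m2: "Measurable.pred graph_space (\<lambda>\<mu>. \<forall>y\<in>verts \<mu>. x \<noteq> y \<longrightarrow> P x y \<mu>)" for x
    proof (rule measurable_config_ball)
      show "Measurable.pred (graph_space \<Otimes>\<^sub>M borel) (\<lambda>(\<mu>, y). x \<noteq> y \<longrightarrow> P x y \<mu>)"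
        unfolding split_beta' by (intro pred_intros_logic(4) P') measurable
    qed measurable
    have m3: "Measurable.pred graph_space (\<lambda>\<mu>. \<forall>x\<in>verts \<mu>. \<forall>y\<in>verts \<mu>. x \<noteq> y \<longrightarrow> P x y \<mu>)"
    proof (rule measurable_config_ball)
      show "Measurable.pred (graph_space \<Otimes>\<^sub>M borel) (\<lambda>(\<mu>, x). \<forall>y\<in>verts \<mu>. x \<noteq> y \<longrightarrow> P x y \<mu>)"
        unfolding split_beta'
      proof (rule measurable_config_ball)
        show "Measurable.pred ((graph_space \<Otimes>\<^sub>M borel) \<Otimes>\<^sub>M borel)
            (\<lambda>(\<omega>, y). snd \<omega> \<noteq> y \<longrightarrow> P (snd \<omega>) y (fst \<omega>))"
          unfolding split_beta' by (intro pred_intros_logic(4) P') measurable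
      qed measurable
    qed measurable
    have "V \<in> configs"
      using V(2) by (simp add: space_Pe)
    then show "AE \<mu> in rcm_kernel \<phi> V. \<forall>x\<in>verts \<mu>. \<forall>y\<in>verts \<mu>. x \<noteq> y \<longrightarrow> P x y \<mu>"
      using V(1) by (intro AE_rcm_kernel_ball_verts m1 m2 m3) auto
  qed
qed

end

section \<open>Uniqueness and deletion stability\<close>

context rcm
begin

text \<open>The set called \<open>S\<close> in the introduction.\<close>

definition may_separate :: "'a \<Rightarrow> 'a \<Rightarrow> bool" where
  "may_separate x y \<longleftrightarrow>
     \<not> (AE V in Pe. AE \<mu> in rcm_kernel \<phi> (insert x (insert y V)). \<not> separated \<mu> x y)"

lemma measurable_may_separate [measurable (raw)]:
  assumes [measurable]: "f \<in> borel_measurable N" "g \<in> borel_measurable N"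
  shows "Measurable.pred N (\<lambda>\<omega>. may_separate (f \<omega>) (g \<omega>))"
proof -
  have "Measurable.pred (N \<Otimes>\<^sub>M config_space)
      (\<lambda>(\<omega>, V). AE \<mu> in rcm_kernel \<phi> (insert (f \<omega>) (insert (g \<omega>) V)). \<not> separated \<mu> (f \<omega>) (g \<omega>))"
    unfolding split_beta'
  proof (rule pred_AE_rcm_kernel)
    show "Measurable.pred ((N \<Otimes>\<^sub>M config_space) \<Otimes>\<^sub>M graph_space)
        (\<lambda>(z, \<mu>). \<not> separated \<mu> (f (fst z)) (g (fst z)))"
      unfolding split_beta' by measurable
  qed measurable
  then have [measurable]: "Measurable.pred N (\<lambda>\<omega>. AE V in Pe.
      AE \<mu> in rcm_kernel \<phi> (insert (f \<omega>) (insert (g \<omega>) V)). \<not> separated \<mu> (f \<omega>) (g \<omega>))"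
    by (rule pred_AE_Pe)
  show ?thesis
    unfolding may_separate_def by measurable
qed

definition good :: "'a graph \<Rightarrow> bool" where
  "good \<mu> \<longleftrightarrow> (\<forall>z\<in>verts \<mu>. \<not> splits z \<mu>) \<and>
     (\<forall>x\<in>verts \<mu>. \<forall>y\<in>verts \<mu>. x \<noteq> y \<longrightarrow> separated \<mu> x y \<longrightarrow> may_separate x y)"

lemma measurable_not_splits: "Measurable.pred graph_space (\<lambda>\<mu> :: 'a graph. \<forall>z\<in>verts \<mu>. \<not> splits z \<mu>)"
proof (rule measurable_config_ball)
  show "Measurable.pred (graph_space \<Otimes>\<^sub>M borel) (\<lambda>(\<mu> :: 'a graph, z). \<not> splits z \<mu>)"
    unfolding split_beta' by measurable
qed measurable

lemma measurable_good: "Measurable.pred graph_space good"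
proof -
  have [measurable]: "Measurable.pred graph_space
      (\<lambda>\<mu>. \<forall>x\<in>verts \<mu>. \<forall>y\<in>verts \<mu>. x \<noteq> y \<longrightarrow> separated \<mu> x y \<longrightarrow> may_separate x y)"
  proof (rule measurable_config_ball)
    show "Measurable.pred (graph_space \<Otimes>\<^sub>M borel)
        (\<lambda>(\<mu>, x). \<forall>y\<in>verts \<mu>. x \<noteq> y \<longrightarrow> separated \<mu> x y \<longrightarrow> may_separate x y)"
      unfolding split_beta'
    proof (rule measurable_config_ball)
      show "Measurable.pred ((graph_space \<Otimes>\<^sub>M borel) \<Otimes>\<^sub>M borel)
          (\<lambda>(z, y). snd z \<noteq> y \<longrightarrow> separated (fst z) (snd z) y \<longrightarrow> may_separate (snd z) y)"
        unfolding split_beta' by measurable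
    qed measurable
  qed measurable
  note [measurable] = measurable_not_splits
  show ?thesis
    unfolding good_def by measurable
qed

lemma good_separatedD:
  "good \<mu> \<Longrightarrow> separated \<mu> x y \<Longrightarrow> may_separate x y"
  unfolding good_def using in_infinite_cluster_verts not_separated_refl by (metis separated_def)

definition stable :: bool where
  "stable \<longleftrightarrow> (AE x in L. AE V in Pe. AE \<mu> in rcm_kernel \<phi> (insert x V). \<not> splits x \<mu>)"

definition irreducible :: bool where
  "irreducible \<longleftrightarrow> (AE x in L. AE y in L.
     \<not> (AE V in Pe. AE \<mu> in rcm_kernel \<phi> (insert x (insert y V)). \<not> connected_in \<mu> x y))"

definition unique :: bool where
  "unique \<longleftrightarrow> (AE V in Pe. AE \<mu> in rcm_kernel \<phi> V.
     \<not> (\<exists>x\<in>verts \<mu>. \<exists>y\<in>verts \<mu>. separated \<mu> x y))"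

text \<open>A pair outside \<open>may_separate\<close> is almost surely not separated after being added, by definition; so
  the Mecke equation for pairs shows that almost surely no two vertices of the process form a
  separated pair outside \<open>may_separate\<close>.\<close>

lemma AE_good:
  assumes stable
  shows "AE V in Pe. AE \<mu> in rcm_kernel \<phi> V. good \<mu>"
proof -
  have "Measurable.pred (borel \<Otimes>\<^sub>M config_space) (\<lambda>(x, V). AE \<mu> in rcm_kernel \<phi> V. \<not> splits x \<mu>)"
    unfolding split_beta'
  proof (rule pred_AE_rcm_kernel)
    show "Measurable.pred ((borel \<Otimes>\<^sub>M config_space) \<Otimes>\<^sub>M graph_space) (\<lambda>(z, \<mu>). \<not> splits (fst z :: 'a) \<mu>)"
      unfolding split_beta' by measurable
  qed measurable
  from iffD2[OF AE_ball_iff_AE_insert[OF this] assms[unfolded stable_def]]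
  have "AE V in Pe. \<forall>x\<in>V. AE \<mu> in rcm_kernel \<phi> V. \<not> splits x \<mu>" .
  moreover have "AE V in Pe. AE \<mu> in rcm_kernel \<phi> V.
      \<forall>x\<in>verts \<mu>. \<forall>y\<in>verts \<mu>. x \<noteq> y \<longrightarrow> (separated \<mu> x y \<longrightarrow> may_separate x y)"
  proof (rule AE_rcm_pairs)
    show "Measurable.pred ((borel \<Otimes>\<^sub>M borel) \<Otimes>\<^sub>M graph_space)
        (\<lambda>((x, y), \<mu>). separated \<mu> x y \<longrightarrow> may_separate x y)"
      unfolding split_beta' by measurable
    have "AE V in Pe. AE \<mu> in rcm_kernel \<phi> (insert x (insert y V)). separated \<mu> x y \<longrightarrow> may_separate x y"
      for x y
    proof (cases "may_separate x y")
      case False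
      then have "AE V in Pe. AE \<mu> in rcm_kernel \<phi> (insert x (insert y V)). \<not> separated \<mu> x y"
        by (simp add: may_separate_def)
      then show ?thesis
        using False by simp
    qed simp
    then show "AE x in L. AE y in L. AE V in Pe. AE \<mu> in rcm_kernel \<phi> (insert x (insert y V)).
        separated \<mu> x y \<longrightarrow> may_separate x y"
      by simp
  qed
  ultimately show ?thesis
    using AE_space[of Pe]
  proof eventually_elim
    fix V assume "\<forall>x\<in>V. AE \<mu> in rcm_kernel \<phi> V. \<not> splits x \<mu>" and V: "V \<in> space Pe"
      and sep: "AE \<mu> in rcm_kernel \<phi> V.
        \<forall>x\<in>verts \<mu>. \<forall>y\<in>verts \<mu>. x \<noteq> y \<longrightarrow> (separated \<mu> x y \<longrightarrow> may_separate x y)"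
    then have "AE \<mu> in rcm_kernel \<phi> V. \<forall>x\<in>verts \<mu>. \<not> splits x \<mu>"
      by (intro AE_rcm_kernel_ball_verts measurable_not_splits) (auto simp: space_Pe)
    with sep show "AE \<mu> in rcm_kernel \<phi> V. good \<mu>"
      by eventually_elim (simp add: good_def)
  qed
qed

lemma AE_good_insert3:
  assumes stable
  shows "AE x in L. AE y in L. AE z in L. AE V in Pe.
    AE \<mu> in rcm_kernel \<phi> (insert x (insert y (insert z V))). good \<mu>"
proof (rule AE_insert3[OF _ AE_good[OF assms]])
  show "Measurable.pred config_space (\<lambda>V. AE \<mu> in rcm_kernel \<phi> V. good \<mu>)"
    by (rule pred_AE_rcm_kernel)
       (auto simp: split_beta' intro: measurable_compose[OF measurable_snd measurable_good])
qed

text \<open>The new point \<open>z\<close> is joined to all points of \<open>F\<close> with positive probability, independently of the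
  graph to which it is added. If this never turned a graph that separates \<open>x\<close> and \<open>y\<close> into a good
  one, then \<open>x\<close> and \<open>y\<close> would almost surely not be separated, against \<open>may_separate x y\<close>. The first
  claim follows with \<open>F = {x}\<close>, the second one with \<open>F = {x, y}\<close>.\<close>

lemma may_separate_propagates:
  assumes good: "AE V in Pe. AE \<mu> in rcm_kernel \<phi> (insert z (insert x (insert y V))). good \<mu>"
    and z: "z \<noteq> x" "z \<noteq> y" and sep: "may_separate x y" and pos: "\<phi> z x > 0"
  shows "may_separate z y" "\<phi> z y = 0"
proof -
  have key: False
    if F: "F = {x} \<or> F = {x, y}" and F': "\<And>w. w \<in> F \<Longrightarrow> 0 < \<phi> z w"
      and imp: "\<And>\<mu>. good \<mu> \<Longrightarrow> separated \<mu> z y \<Longrightarrow> (z, y) \<notin> adj \<mu> \<Longrightarrow> \<forall>w\<in>F. (z, w) \<in> adj \<mu> \<Longrightarrow> False" for F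
  proof -
    have "AE V in Pe. AE \<mu> in rcm_kernel \<phi> (insert x (insert y V)). \<not> separated \<mu> x y"
      using good AE_not_mem[of z] AE_space[of Pe]
    proof eventually_elim
      fix V assume ae: "AE \<mu> in rcm_kernel \<phi> (insert z (insert x (insert y V))). good \<mu>"
        and V: "z \<notin> V" "V \<in> space Pe"
      let ?W = "insert x (insert y V)"
      have W: "?W \<in> configs" "z \<notin> ?W"
        using V z by (auto simp: space_Pe intro!: configs_insert)
      have "AE \<mu> in rcm_kernel \<phi> (insert z ?W).
          \<not> ((\<forall>w\<in>F. (z, w) \<in> adj \<mu>) \<and> separated (delete_vertex \<mu> z) x y)"
        using ae AE_space
      proof eventually_elim
        fix \<mu> assume g: "good \<mu>" and "\<mu> \<in> space (rcm_kernel \<phi> (insert z ?W))"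
        then have \<mu>: "\<mu> \<in> graphs" by simp
        show "\<not> ((\<forall>w\<in>F. (z, w) \<in> adj \<mu>) \<and> separated (delete_vertex \<mu> z) x y)"
        proof
          assume *: "(\<forall>w\<in>F. (z, w) \<in> adj \<mu>) \<and> separated (delete_vertex \<mu> z) x y"
          then have zx: "(z, x) \<in> adj \<mu>"
            using F by auto
          then have "\<not> splits z \<mu>"
            using g graphsD(2)[OF \<mu>] by (auto simp: good_def)
          from separated_by_added_vertex[OF \<mu> this _ zx] * show False
            using imp[OF g] by blast
        qed
      qed
      moreover have "Measurable.pred graph_space (\<lambda>\<mu>. separated \<mu> x y)"
        by measurable
      ultimately show "AE \<mu> in rcm_kernel \<phi> ?W. \<not> separated \<mu> x y"
        using F F' by (intro AE_rcm_kernel_insert[OF W, of F]) auto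
    qed
    with sep show False
      by (simp add: may_separate_def)
  qed
  show "may_separate z y"
  proof (rule ccontr)
    assume not: "\<not> may_separate z y"
    show False
    proof (rule key[of "{x}"])
      show "0 < \<phi> z w" if "w \<in> {x}" for w
        using that pos by simp
      show False if "good \<mu>" "separated \<mu> z y" for \<mu>
        using good_separatedD[OF that] not by contradiction
    qed simp
  qed
  show "\<phi> z y = 0"
  proof (rule ccontr)
    assume "\<phi> z y \<noteq> 0"
    then have "0 < \<phi> z y"
      using connection_nonneg[of z y] by simp
    show False
    proof (rule key[of "{x, y}"])
      show "0 < \<phi> z w" if "w \<in> {x, y}" for w
        using that pos \<open>0 < \<phi> z y\<close> by auto
      show False if "(z, y) \<notin> adj \<mu>" "\<forall>w\<in>{x, y}. (z, w) \<in> adj \<mu>" for \<mu>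
        using that by simp
    qed simp
  qed
qed

text \<open>The two orders of the last two quantifiers are obtained by adding the three points in
  different orders.\<close>

lemma AE_may_separate_propagates:
  assumes stable
  shows "AE y in L. AE x in L. AE z in L. may_separate x y \<and> \<phi> z x > 0 \<longrightarrow> may_separate z y \<and> \<phi> z y = 0"
    and "AE y in L. AE z in L. AE x in L. may_separate x y \<and> \<phi> z x > 0 \<longrightarrow> may_separate z y \<and> \<phi> z y = 0"
proof -
  show "AE y in L. AE x in L. AE z in L. may_separate x y \<and> \<phi> z x > 0 \<longrightarrow> may_separate z y \<and> \<phi> z y = 0"
    using AE_good_insert3[OF assms]
  proof eventually_elim
    case (elim y)
    then show ?case
    proof eventually_elim
      case (elim x)
      then show ?case
        using AE_neq[of x] AE_neq[of y]
      proof eventually_elim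
        case (elim z)
        have "insert y (insert x (insert z V)) = insert z (insert x (insert y V))" for V
          by auto
        from elim(1)[unfolded this] show ?case
          using may_separate_propagates[of z x y] elim(2,3) by blast
      qed
    qed
  qed
  show "AE y in L. AE z in L. AE x in L. may_separate x y \<and> \<phi> z x > 0 \<longrightarrow> may_separate z y \<and> \<phi> z y = 0"
    using AE_good_insert3[OF assms]
  proof eventually_elim
    case (elim y)
    then show ?case
      using AE_neq[of y]
    proof eventually_elim
      case (elim z)
      note zy = elim(2)
      from elim(1) show ?case
        using AE_neq[of z]
      proof eventually_elim
        case (elim x)
        have "insert y (insert z (insert x V)) = insert z (insert x (insert y V))" for V
          by auto
        from elim(1)[unfolded this] show ?case
          using may_separate_propagates[of z x y] elim(2) zy by blast
      qed
    qed
  qed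
qed

text \<open>If \<open>\<phi>\<close> vanishes almost everywhere on \<open>R\<close>, then almost surely no edge of the process with two
  added points \<open>x\<close> and \<open>y\<close> belongs to \<open>R\<close>. With positive probability \<open>x\<close> and \<open>y\<close> are connected, so
  that every set which contains \<open>x\<close> but not \<open>y\<close> is left by some edge, which is then not in \<open>R\<close>.\<close>

lemma AE_crossing:
  assumes irr: irreducible
    and R: "Measurable.pred (borel \<Otimes>\<^sub>M borel) (\<lambda>(x, y). R x y)"
    and zero: "AE x in L. AE y in L. R x y \<longrightarrow> \<phi> x y = 0"
  shows "AE x in L. AE y in L. \<forall>T. T x \<and> \<not> T y \<longrightarrow> (\<exists>u v. T u \<and> \<not> T v \<and> \<not> R u v)"
proof -
  have R': "Measurable.pred N (\<lambda>\<omega>. R (f \<omega>) (g \<omega>))"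
    if [measurable]: "f \<in> borel_measurable N" "g \<in> borel_measurable N" for f g and N :: "'b measure"
  proof -
    have "(\<lambda>\<omega>. (f \<omega>, g \<omega>)) \<in> N \<rightarrow>\<^sub>M borel \<Otimes>\<^sub>M borel"
      by measurable
    from measurable_compose[OF this R] show ?thesis
      by simp
  qed
  define E where "E \<mu> \<longleftrightarrow> (\<forall>x\<in>verts \<mu>. \<forall>y\<in>verts \<mu>. x \<noteq> y \<longrightarrow> (R x y \<longrightarrow> (x, y) \<notin> adj \<mu>))" for \<mu>
  have E: "Measurable.pred graph_space E"
    unfolding E_def
  proof (rule measurable_config_ball)
    show "Measurable.pred (graph_space \<Otimes>\<^sub>M borel)
        (\<lambda>(\<mu>, x). \<forall>y\<in>verts \<mu>. x \<noteq> y \<longrightarrow> (R x y \<longrightarrow> (x, y) \<notin> adj \<mu>))"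
      unfolding split_beta'
    proof (rule measurable_config_ball)
      have [measurable]: "Measurable.pred ((graph_space \<Otimes>\<^sub>M borel) \<Otimes>\<^sub>M borel) (\<lambda>z. R (snd (fst z)) (snd z))"
        by (rule R') measurable
      show "Measurable.pred ((graph_space \<Otimes>\<^sub>M borel) \<Otimes>\<^sub>M borel)
          (\<lambda>(z, y). snd z \<noteq> y \<longrightarrow> (R (snd z) y \<longrightarrow> (snd z, y) \<notin> adj (fst z)))"
        unfolding split_beta' by measurable
    qed measurable
  qed measurable
  have "AE V in Pe. AE \<mu> in rcm_kernel \<phi> V. E \<mu>"
    unfolding E_def
  proof (rule AE_rcm_pairs)
    have [measurable]: "Measurable.pred ((borel \<Otimes>\<^sub>M borel) \<Otimes>\<^sub>M graph_space) (\<lambda>z. R (fst (fst z)) (snd (fst z)))"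
      by (rule R') measurable
    show "Measurable.pred ((borel \<Otimes>\<^sub>M borel) \<Otimes>\<^sub>M graph_space) (\<lambda>((x, y), \<mu>). R x y \<longrightarrow> (x, y) \<notin> adj \<mu>)"
      unfolding split_beta' by measurable
    from zero show "AE x in L. AE y in L. AE V in Pe. AE \<mu> in rcm_kernel \<phi> (insert x (insert y V)).
        R x y \<longrightarrow> (x, y) \<notin> adj \<mu>"
    proof eventually_elim
      case (elim x)
      then show ?case
        using AE_neq[of x]
      proof eventually_elim
        case (elim y)
        show ?case
        proof (cases "R x y")
          case True
          show ?thesis
            using AE_space[of Pe]
          proof eventually_elim
            case (elim V)
            then have "insert x (insert y V) \<in> configs"
              by (simp add: space_Pe configs_insert)
            from AE_rcm_kernel_no_edge[OF this, of x y]
            show ?case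
              using True \<open>R x y \<longrightarrow> \<phi> x y = 0\<close> \<open>y \<noteq> x\<close> by auto
          qed
        qed simp
      qed
    qed
  qed
  moreover have "Measurable.pred config_space (\<lambda>V. AE \<mu> in rcm_kernel \<phi> V. E \<mu>)"
    by (rule pred_AE_rcm_kernel) (auto simp: split_beta' intro: measurable_compose[OF measurable_snd E])
  ultimately have "AE x in L. AE y in L. AE V in Pe. AE \<mu> in rcm_kernel \<phi> (insert x (insert y V)). E \<mu>"
    by (intro AE_insert2)
  then show ?thesis
    using irr[unfolded irreducible_def]
  proof eventually_elim
    case (elim x)
    from elim show ?case
    proof eventually_elim
      case (elim y)
      show ?case
      proof (intro allI impI, rule ccontr)
        fix T assume T: "T x \<and> \<not> T y" and no: "\<not> (\<exists>u v. T u \<and> \<not> T v \<and> \<not> R u v)"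
        have "AE V in Pe. AE \<mu> in rcm_kernel \<phi> (insert x (insert y V)). \<not> connected_in \<mu> x y"
          using elim(1)
        proof eventually_elim
          case (elim V)
          then show ?case
            using AE_space
          proof eventually_elim
            case (elim \<mu>)
            then have \<mu>: "\<mu> \<in> graphs" by simp
            show ?case
            proof
              assume "connected_in \<mu> x y"
              then obtain u v where uv: "(u, v) \<in> adj \<mu>" "T u" "\<not> T v"
                using connected_in_crossing_edge[of \<mu> x y T] T by blast
              then have "R u v" "u \<noteq> v"
                using no by auto
              then show False
                using elim(1) uv(1) graphsD(2,3)[OF \<mu> uv(1)] by (simp add: E_def)
            qed
          qed
        qed
        with elim(2) show False ..
      qed
    qed
  qed
qed

theorem unique_if_stable:
  assumes irr: irreducible and st: stable
  shows unique
proof -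
  \<comment> \<open>Almost every point can have neighbours: otherwise the set \<open>{x}\<close> could not be left.\<close>
  have Z: "AE x in L. AE y in L. \<not> (AE z in L. \<phi> x z = 0)"
  proof -
    have [measurable]: "Measurable.pred borel (\<lambda>x. AE z in L. \<phi> x z = 0)"
      by (rule pred_AE_L) (unfold split_beta', measurable)
    have "AE x in L. AE y in L. \<forall>T. T x \<and> \<not> T y \<longrightarrow> (\<exists>u v. T u \<and> \<not> T v \<and> \<not> (AE z in L. \<phi> u z = 0))"
    proof (rule AE_crossing[OF irr])
      show "Measurable.pred (borel \<Otimes>\<^sub>M borel) (\<lambda>(x, y :: 'a). AE z in L. \<phi> x z = 0)"
        unfolding split_beta' by measurable
      show "AE x in L. AE y in L. (AE z in L. \<phi> x z = 0) \<longrightarrow> \<phi> x y = 0"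
      proof (rule AE_I2)
        show "AE y in L. (AE z in L. \<phi> x z = 0) \<longrightarrow> \<phi> x y = 0" for x
          by (cases "AE z in L. \<phi> x z = 0") auto
      qed
    qed
    then show ?thesis
    proof eventually_elim
      case (elim x)
      then show ?case
        using AE_neq[of x] by eventually_elim (auto dest: spec[of _ "\<lambda>v. v = x"])
    qed
  qed
  have Z': "AE x in L. \<not> (AE z in L. \<phi> x z = 0)"
  proof (cases "AE y in L. False")
    case True
    then show ?thesis by (rule AE_mp) simp
  next
    case False
    then have "(AE y in L. \<not> P) \<Longrightarrow> \<not> P" for P
      by (cases P) auto
    with Z show ?thesis
      by auto
  qed
  have "AE y in L. AE x in L. \<not> may_separate x y"
    using AE_may_separate_propagates[OF st] Z'
  proof eventually_elim
    case (elim y)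
    have "AE x in L. AE z in L. \<forall>T. T x \<and> \<not> T z \<longrightarrow>
        (\<exists>u v. T u \<and> \<not> T v \<and> \<not> (may_separate u y \<and> \<not> may_separate v y))"
    proof (rule AE_crossing[OF irr])
      show "Measurable.pred (borel \<Otimes>\<^sub>M borel) (\<lambda>(u, v). may_separate u y \<and> \<not> may_separate v y)"
        unfolding split_beta' by measurable
      from elim(1) show "AE u in L. AE v in L. may_separate u y \<and> \<not> may_separate v y \<longrightarrow> \<phi> u v = 0"
      proof eventually_elim
        case (elim u)
        then show ?case
        proof eventually_elim
          case (elim v)
          then show ?case
            using connection_nonneg[of u v] connection_sym[of u v] by (auto simp: less_le)
        qed
      qed
    qed
    \<comment> \<open>The section of \<open>may_separate\<close> at \<open>y\<close> cannot be left; so it is null or conull.\<close>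
    then have dich: "AE x in L. AE z in L. may_separate x y \<longrightarrow> may_separate z y"
    proof eventually_elim
      case (elim x)
      then show ?case
        by eventually_elim (auto dest: spec[of _ "\<lambda>u. may_separate u y"])
    qed
    show ?case
    proof (rule ccontr)
      assume not: "\<not> (AE x in L. \<not> may_separate x y)"
      have "AE z in L. may_separate z y"
      proof (rule ccontr)
        assume *: "\<not> (AE z in L. may_separate z y)"
        have "AE x in L. \<not> may_separate x y"
          using dich
        proof eventually_elim
          case (elim x)
          with * show ?case by (cases "may_separate x y") auto
        qed
        with not show False ..
      qed
      note all = this
      \<comment> \<open>In the conull case a point \<open>z\<close> with possible neighbours cannot be a neighbour of \<open>y\<close>.\<close>
      have "AE z in L. \<phi> y z = 0"
        using elim(2) Z'
      proof eventually_elim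
        case (elim z)
        have "\<phi> z y = 0"
        proof (rule ccontr)
          assume *: "\<phi> z y \<noteq> 0"
          have "AE x in L. \<phi> z x = 0"
            using elim(1) all
          proof eventually_elim
            case (elim x)
            then show ?case
              using * connection_nonneg[of z x] by (auto simp: less_le)
          qed
          with elim(2) show False ..
        qed
        then show ?case
          by (simp add: connection_sym[of y z])
      qed
      with elim(3) show False ..
    qed
  qed
  then have "AE y in L. AE x in L. AE V in Pe.
      AE \<mu> in rcm_kernel \<phi> (insert y (insert x V)). \<not> separated \<mu> x y"
  proof eventually_elim
    case (elim y)
    then show ?case
    proof eventually_elim
      case (elim x)
      then show ?case
        unfolding may_separate_def not_not insert_commute[of x y] .
    qed
  qed
  moreover have "Measurable.pred ((borel \<Otimes>\<^sub>M borel) \<Otimes>\<^sub>M graph_space)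
      (\<lambda>((y, x), \<mu> :: 'a graph). \<not> separated \<mu> x y)"
    unfolding split_beta' by measurable
  ultimately have "AE V in Pe. AE \<mu> in rcm_kernel \<phi> V.
      \<forall>y\<in>verts \<mu>. \<forall>x\<in>verts \<mu>. y \<noteq> x \<longrightarrow> \<not> separated \<mu> x y"
    by (intro AE_rcm_pairs)
  then show ?thesis
    unfolding unique_def
  proof eventually_elim
    case (elim V)
    then show ?case
      by eventually_elim (metis not_separated_refl)
  qed
qed

theorem stable_if_unique:
  assumes unique
  shows stable
  unfolding stable_def
proof (rule AE_I2)
  fix x
  show "AE V in Pe. AE \<mu> in rcm_kernel \<phi> (insert x V). \<not> splits x \<mu>"
    using assms[unfolded unique_def] AE_not_mem[of x] AE_space[of Pe]
  proof eventually_elim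
    case (elim V)
    have "Measurable.pred graph_space (\<lambda>\<mu> :: 'a graph. \<not> (\<exists>x\<in>verts \<mu>. \<exists>y\<in>verts \<mu>. separated \<mu> x y))"
      by measurable
    then have "AE \<mu> in rcm_kernel \<phi> (insert x V).
        \<not> (\<exists>y\<in>verts (delete_vertex \<mu> x). \<exists>z\<in>verts (delete_vertex \<mu> x). separated (delete_vertex \<mu> x) y z)"
      using elim by (intro AE_rcm_kernel_delete) (auto simp: space_Pe)
    then show ?case
      by eventually_elim (auto dest: splits_imp_separated)
  qed
qed

end

theorem theorem6p1:
  fixes L :: "'a::polish_space measure"
    and \<phi> :: "'a \<Rightarrow> 'a \<Rightarrow> real"
    and M :: "'w measure"
    and \<eta> :: "'w \<Rightarrow> 'a set"
    and \<xi> :: "'w \<Rightarrow> 'a graph"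
  assumes "sets L = sets borel" and "locally_finite_measure L" and "diffuse L"
    and "connection_function L \<phi>"
    and "poisson_process M L \<eta>"
    and "is_rcm \<phi> M \<eta> \<xi>"
  shows "(irreducible_rcm L \<phi> M \<eta> \<and> deletion_stable L \<phi> M \<eta> \<longrightarrow>
            (AE \<omega> in M. ecard (infinite_clusters (\<xi> \<omega>)) \<le> 1)) \<and>
         ((AE \<omega> in M. ecard (infinite_clusters (\<xi> \<omega>)) \<le> 1) \<longrightarrow> deletion_stable L \<phi> M \<eta>)"
proof -
  have \<eta>: "\<eta> \<in> M \<rightarrow>\<^sub>M config_space" and "prob_space M"
    using assms(5) by (simp_all add: poisson_process_def)
  define Pe where "Pe = distr M config_space \<eta>"
  interpret connection \<phi>
    using assms(4) by unfold_locales (auto simp: connection_function_def)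
  interpret rcm Pe L \<phi>
  proof (intro rcm.intro poisson_law.intro poisson_law_axioms.intro rcm_axioms.intro)
    show "prob_space Pe"
      unfolding Pe_def by (rule prob_space.prob_space_distr[OF \<open>prob_space M\<close> \<eta>])
    show "connection \<phi>"
      by (rule connection_axioms)
    show "emeasure L {x} = 0" for x
      using assms(3) by (simp add: diffuse_def)
  qed (use assms(1,2) poisson_process_count_void[OF assms(5)] in \<open>simp_all add: Pe_def\<close>)
  have stable_iff: "deletion_stable L \<phi> M \<eta> \<longleftrightarrow> stable"
  proof -
    have "(AE \<mu> in rcm_added \<phi> M \<eta> [x]. \<not> 2 \<le> N_inf x \<mu>) \<longleftrightarrow>
        (AE V in Pe. AE \<mu> in rcm_kernel \<phi> (insert x V). \<not> splits x \<mu>)" for x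
    proof -
      have "Measurable.pred graph_space (\<lambda>\<mu>. \<not> splits x \<mu>)"
        by measurable
      then have m: "Measurable.pred graph_space (\<lambda>\<mu>. \<not> 2 \<le> N_inf x \<mu>)"
        by (subst measurable_cong[where g = "\<lambda>\<mu>. \<not> splits x \<mu>"]) (simp_all add: N_inf_ge_2_iff)
      have f: "(\<lambda>V. insert x V) \<in> config_space \<rightarrow>\<^sub>M config_space"
        by measurable
      have added: "rcm_added \<phi> M \<eta> [x] = rcm_law \<phi> M (\<lambda>\<omega>. insert x (\<eta> \<omega>))"
        by (simp add: rcm_added_def)
      have "(AE \<mu> in rcm_added \<phi> M \<eta> [x]. \<not> 2 \<le> N_inf x \<mu>) \<longleftrightarrow>
          (AE V in Pe. AE \<mu> in rcm_kernel \<phi> (insert x V). \<not> 2 \<le> N_inf x \<mu>)"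
        unfolding added Pe_def by (rule AE_rcm_law_iff[OF \<eta> f m])
      also have "\<dots> \<longleftrightarrow> (AE V in Pe. AE \<mu> in rcm_kernel \<phi> (insert x V). \<not> splits x \<mu>)"
        by (intro AE_cong) (simp add: N_inf_ge_2_iff)
      finally show ?thesis .
    qed
    then show ?thesis
      by (simp add: deletion_stable_def stable_def)
  qed
  have irreducible: irreducible if "irreducible_rcm L \<phi> M \<eta>"
  proof -
    interpret LL: pair_sigma_finite L L
      by (intro pair_sigma_finite.intro L.sigma_finite_measure_axioms)
    have "AE x in L. AE y in L. \<P>(\<mu> in rcm_added \<phi> M \<eta> [x, y]. connected_in \<mu> x y) > 0"
      using LL.AE_pair[OF that[unfolded irreducible_rcm_def]] by simp
    moreover have "\<not> (AE V in Pe. AE \<mu> in rcm_kernel \<phi> (insert x (insert y V)). \<not> connected_in \<mu> x y)"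
      if pos: "\<P>(\<mu> in rcm_added \<phi> M \<eta> [x, y]. connected_in \<mu> x y) > 0" for x y
    proof
      assume ae: "AE V in Pe. AE \<mu> in rcm_kernel \<phi> (insert x (insert y V)). \<not> connected_in \<mu> x y"
      have f: "(\<lambda>V. insert x (insert y V)) \<in> config_space \<rightarrow>\<^sub>M config_space"
        by measurable
      have P: "Measurable.pred graph_space (\<lambda>\<mu>. \<not> connected_in \<mu> x y)"
        by measurable
      have added: "rcm_added \<phi> M \<eta> [x, y] = rcm_law \<phi> M (\<lambda>\<omega>. insert x (insert y (\<eta> \<omega>)))"
        by (simp add: rcm_added_def)
      have "AE \<mu> in rcm_added \<phi> M \<eta> [x, y]. \<not> connected_in \<mu> x y"
        unfolding added by (rule iffD2[OF AE_rcm_law_iff[OF \<eta> f P] ae[unfolded Pe_def]])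
      then have "emeasure (rcm_added \<phi> M \<eta> [x, y]) {\<mu> \<in> space (rcm_added \<phi> M \<eta> [x, y]). connected_in \<mu> x y} = 0"
        by (rule emeasure_eq_0_AE)
      with pos show False
        by (simp add: measure_def)
    qed
    ultimately show ?thesis
      unfolding irreducible_def by auto
  qed
  have unique_iff: "(AE \<omega> in M. ecard (infinite_clusters (\<xi> \<omega>)) \<le> 1) \<longleftrightarrow> unique"
  proof -
    have \<xi>: "\<xi> \<in> M \<rightarrow>\<^sub>M graph_space" and law: "distr M graph_space \<xi> = rcm_law \<phi> M \<eta>"
      using assms(6) by (auto simp: is_rcm_def)
    let ?S = "\<lambda>\<mu> :: 'a graph. \<exists>x\<in>verts \<mu>. \<exists>y\<in>verts \<mu>. separated \<mu> x y"
    have P: "Measurable.pred graph_space (\<lambda>\<mu>. \<not> ?S \<mu>)"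
      by measurable
    have "(AE \<omega> in M. ecard (infinite_clusters (\<xi> \<omega>)) \<le> 1) \<longleftrightarrow> (AE \<omega> in M. \<not> ?S (\<xi> \<omega>))"
      using measurable_space[OF \<xi>]
      by (intro AE_cong) (simp add: enat_le_1_iff two_le_infinite_clusters_iff)
    also have "\<dots> \<longleftrightarrow> (AE \<mu> in distr M graph_space \<xi>. \<not> ?S \<mu>)"
      using P \<xi> by (intro AE_distr_iff[symmetric]) (simp_all add: pred_def)
    also have "\<dots> \<longleftrightarrow> unique"
      unfolding law unique_def unfolding Pe_def by (rule AE_rcm_law_iff[OF \<eta> measurable_ident_sets[OF refl] P])
    finally show ?thesis .
  qed
  show ?thesis
    unfolding stable_iff unique_iff using irreducible unique_if_stable stable_if_unique by blast
qed

end
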